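(* Let $W_1,\dots,W_k$ be subgroups of $S_d$ and let $\chi_m\colon W_m\to K$ be a one-dimensional character of $W_m$, $m=1,\dots,k$. Let $I_m$ be a left transversal of $W_m$ in $S_d$, let $I=I_1\times\cdots\times I_k$ with the $S_d$-action $s$ described in the context, and let $T(W_1,\dots,W_k)\subseteq I$ be a system of distinct representatives of the $S_d$-orbits in $I$. For $\omega=(\omega_1,\dots,\omega_k)\in T(W_1,\dots,W_k)$ let $\psi_{(\omega_1,\dots,\omega_k)}$ be the one-dimensional character of the group $\omega_1W_1\omega_1^{-1}\cap\cdots\cap\omega_kW_k\omega_k^{-1}$ which is the restriction of $\beta_\omega(\zeta)=\prod_{m=1}^k\chi_m\bigl((s_m(\zeta)(\omega_m))^{-1}\zeta\omega_m\bigr)$. Then $$ Z(\chi_1;p_1,\dots,p_d)\ast\cdots\ast Z(\chi_k;p_1,\dots,p_d)=\sum_{(\omega_1,\dots,\omega_k)\in T(W_1,\dots,W_k)}Z\bigl(\psi_{(\omega_1,\dots,\omega_k)};p_1,\dots,p_d\bigr). $$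
   Context: $K$ is an algebraically closed field of characteristic zero; $d,k\ge 1$; $S_d$ is the symmetric group. A one-dimensional character of a group $W$ is a homomorphism $\chi\colon W\to K^*$. For each $m$, $s_m\colon S_d\to S(I_m)$ is the homomorphism determined by: $s_m(\zeta)(i)$ is the unique $j\in I_m$ with $j^{-1}\zeta i\in W_m$. The action $s$ of $S_d$ on $I$ is $s(\zeta)(i_1,\dots,i_k)=(s_1(\zeta)(i_1),\dots,s_k(\zeta)(i_k))$. The stabilizer of $(\omega_1,\dots,\omega_k)\in I$ is $\omega_1W_1\omega_1^{-1}\cap\cdots\cap\omega_kW_k\omega_k^{-1}$. For $W\le S_d$ and a one-dimensional character $\chi$ of $W$, the generalized cyclic index is $$Z(\chi;p_1,\dots,p_d)=|W|^{-1}\sum_{\sigma\in W}\chi(\sigma)p_1^{c_1(\sigma)}\cdots p_d^{c_d(\sigma)},$$ where $c_s(\sigma)$ is the number of cycles of length $s$ of $\sigma$ and $p_s=\sum_{i\ge 0}x_i^s$ are the power sums in the variables $x_0,x_1,x_2,\dots$. Let $R^d$ be the group of generalized (virtual) characters of $S_d$, $\Lambda^d$ the group of homogeneous degree $d$ symmetric functions with integer coefficients in $x_0,x_1,\dots$, and $ch\colon R^d\to\Lambda^d$ the (bijective) characteristic map $ch(u)=\frac1{d!}\sum_{\sigma\in S_d}u(\sigma)p_1^{c_1(\sigma)}\cdots p_d^{c_d(\sigma)}$. One has $Z(\chi;p_1,\dots,p_d)=ch(\mathrm{ind}_W^{S_d}(\chi))\in\Lambda^d$. The internal product on $\Lambda^d$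 is defined by $ch(u)\ast ch(v)=ch(uv)$, with $uv$ the pointwise product. *)

theory Defs
  imports
    "HOL-Library.Multiset"
    "HOL-Library.FuncSet"
    "HOL-Computational_Algebra.Polynomial"
    "HOL-Combinatorics.Orbits"
    "HOL-Algebra.Sym_Groups"
    "HOL-Algebra.Left_Coset"
    "HOL-Algebra.Group_Action"
    "Jordan_Normal_Form.Matrix"
    "Jordan_Normal_Form.VS_Connect"
begin

section \<open>Formal power series in the variables x_0, x_1, x_2, ...\<close>

text \<open>
  A monomial is the multiset of the indices of its variables, counted with their exponents: the
  multiset \<open>{#i, i, j#}\<close> stands for x_i^2 x_j. A series is its family of coefficients, and
  multiplying monomials is adding multisets.
\<close>

typedef 'a mseries = "UNIV :: (nat multiset \<Rightarrow> 'a) set"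
  morphisms mcoeff Mseries ..

lemma mcoeff_Mseries [simp]: "mcoeff (Mseries f) = f"
  by (simp add: Mseries_inverse)

lemma mseries_eqI: "(\<And>M. mcoeff f M = mcoeff g M) \<Longrightarrow> f = g"
  by (metis ext mcoeff_inverse)

lemma finite_mset_splits: "finite {(A, B). A + B = (M :: 'b multiset)}"
proof -
  have "{(A, B). A + B = M} \<subseteq> (\<lambda>A. (A, M - A)) ` {A. A \<subseteq># M}"
    by auto
  moreover have "finite {A. A \<subseteq># M}"
  proof -
    have "{A. A \<subseteq># M} \<subseteq> mset ` {xs. set xs \<subseteq> set_mset M \<and> length xs \<le> size M}"
    proof
      fix A assume "A \<in> {A. A \<subseteq># M}"
      moreover obtain xs where "A = mset xs"
        by (metis ex_mset)
      ultimately show "A \<in> mset ` {xs. set xs \<subseteq> set_mset M \<and> length xs \<le> size M}"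
        using set_mset_mono[of A M] size_mset_mono[of A M] by auto
    qed
    then show ?thesis
      using finite_lists_length_le[of "set_mset M" "size M"] finite_subset by blast
  qed
  ultimately show ?thesis
    by (meson finite_imageI finite_subset)
qed

lemma finite_mset_splits3: "finite {(A, B, C). A + B + C = (M :: 'b multiset)}"
proof -
  let ?S = "{(A, B). A + B = M}"
  have "{(A, B, C). A + B + C = M} \<subseteq> fst ` ?S \<times> fst ` ?S \<times> fst ` ?S"
  proof (clarify, intro conjI SigmaI)
    fix A B C :: "'b multiset"
    show "A \<in> fst ` {(A', B'). A' + B' = A + B + C}"
      by (rule image_eqI[of _ _ "(A, B + C)"]) (auto simp: ac_simps)
    show "B \<in> fst ` {(A', B'). A' + B' = A + B + C}"
      by (rule image_eqI[of _ _ "(B, A + C)"]) (auto simp: ac_simps)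
    show "C \<in> fst ` {(A', B'). A' + B' = A + B + C}"
      by (rule image_eqI[of _ _ "(C, A + B)"]) (auto simp: ac_simps)
  qed
  then show ?thesis
    using finite_mset_splits[of M] by (meson finite_SigmaI finite_imageI finite_subset)
qed

instantiation mseries :: (comm_ring_1) comm_ring_1
begin

definition "0 = Mseries (\<lambda>_. 0)"
definition "1 = Mseries (\<lambda>M. if M = {#} then 1 else 0)"
definition "f + g = Mseries (\<lambda>M. mcoeff f M + mcoeff g M)"
definition "f - g = Mseries (\<lambda>M. mcoeff f M - mcoeff g M)"
definition "- f = Mseries (\<lambda>M. - mcoeff f M)"
definition "f * g = Mseries (\<lambda>M. \<Sum>(A, B)\<in>{(A, B). A + B = M}. mcoeff f A * mcoeff g B)"

lemmas mseries_defs =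
  zero_mseries_def one_mseries_def plus_mseries_def minus_mseries_def uminus_mseries_def
  times_mseries_def

instance
proof
  fix f g h :: "'a mseries"
  show "f * g * h = f * (g * h)"
  proof (rule mseries_eqI)
    fix M
    let ?t = "\<lambda>A B C. mcoeff f A * mcoeff g B * mcoeff h C"
    let ?T = "\<Sum>(A, B, C)\<in>{(A, B, C). A + B + C = M}. ?t A B C"
    have "mcoeff (f * g * h) M =
        (\<Sum>(D, C)\<in>{(D, C). D + C = M}. \<Sum>(A, B)\<in>{(A, B). A + B = D}. ?t A B C)"
      by (simp add: times_mseries_def sum_distrib_right case_prod_unfold)
    also have "\<dots> = (\<Sum>((D, C), (A, B))\<in>(SIGMA (D, C):{(D, C). D + C = M}. {(A, B). A + B = D}). ?t A B C)"
      using finite_mset_splits by (subst sum.Sigma[symmetric]) (auto simp: case_prod_unfold)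
    also have "\<dots> = ?T"
      by (rule sum.reindex_bij_witness
            [where j = "\<lambda>((D, C), (A, B)). (A, B, C)" and i = "\<lambda>(A, B, C). ((A + B, C), (A, B))"]) auto
    finally have 1: "mcoeff (f * g * h) M = ?T" .
    have "mcoeff (f * (g * h)) M =
        (\<Sum>(A, D)\<in>{(A, D). A + D = M}. \<Sum>(B, C)\<in>{(B, C). B + C = D}. ?t A B C)"
      by (simp add: times_mseries_def sum_distrib_left case_prod_unfold mult.assoc)
    also have "\<dots> = (\<Sum>((A, D), (B, C))\<in>(SIGMA (A, D):{(A, D). A + D = M}. {(B, C). B + C = D}). ?t A B C)"
      using finite_mset_splits by (subst sum.Sigma[symmetric]) (auto simp: case_prod_unfold)
    also have "\<dots> = ?T"
      by (rule sum.reindex_bij_witness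
            [where j = "\<lambda>((A, D), (B, C)). (A, B, C)" and i = "\<lambda>(A, B, C). ((A, B + C), (B, C))"])
         (auto simp: ac_simps)
    finally show "mcoeff (f * g * h) M = mcoeff (f * (g * h)) M"
      using 1 by simp
  qed
  show "f * g = g * f"
    unfolding times_mseries_def
    by (rule arg_cong[of _ _ Mseries], rule ext,
        rule sum.reindex_bij_witness[where j = prod.swap and i = prod.swap])
       (auto simp: ac_simps)
  show "1 * f = f"
  proof (rule mseries_eqI)
    fix M
    have "mcoeff (1 * f) M = (\<Sum>(A, B)\<in>{(A, B). A + B = M}. (if A = {#} then 1 else 0) * mcoeff f B)"
      by (simp add: times_mseries_def one_mseries_def)
    also have "\<dots> = (\<Sum>(A, B)\<in>{({#} :: nat multiset, M)}. (if A = {#} then 1 else 0) * mcoeff f B)"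
      by (rule sum.mono_neutral_right[OF finite_mset_splits]) (auto split: if_splits)
    finally show "mcoeff (1 * f) M = mcoeff f M"
      by simp
  qed
  show "(f + g) * h = f * h + g * h"
    by (rule mseries_eqI)
       (simp add: times_mseries_def plus_mseries_def case_prod_unfold distrib_right sum.distrib)
  show "(0 :: 'a mseries) \<noteq> 1"
  proof
    assume "(0 :: 'a mseries) = 1"
    then have "mcoeff (0 :: 'a mseries) {#} = mcoeff 1 {#}"
      by simp
    then show False
      by (simp add: zero_mseries_def one_mseries_def)
  qed
qed (auto intro!: mseries_eqI simp: zero_mseries_def plus_mseries_def minus_mseries_def uminus_mseries_def)

end

definition mconst :: "'a :: comm_ring_1 \<Rightarrow> 'a mseries" where
  "mconst c = Mseries (\<lambda>M. if M = {#} then c else 0)"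

definition power_sum :: "nat \<Rightarrow> 'a :: comm_ring_1 mseries" where
  "power_sum s = Mseries (\<lambda>M. if \<exists>i. M = replicate_mset s i then 1 else 0)"
  \<comment> \<open>Meant for \<open>s \<ge> 1\<close>, where \<open>i\<close> is determined by \<open>M\<close>; there is no power sum for \<open>s = 0\<close>.\<close>


section \<open>Cyclic indices, virtual characters and the internal product\<close>

definition cycle_count :: "nat \<Rightarrow> nat \<Rightarrow> (nat \<Rightarrow> nat) \<Rightarrow> nat" where
  "cycle_count d s \<sigma> = card {C. C \<subseteq> {1..d} \<and> cyclic_on \<sigma> C \<and> card C = s}"

definition cycle_monomial :: "nat \<Rightarrow> (nat \<Rightarrow> nat) \<Rightarrow> 'a :: comm_ring_1 mseries" where
  "cycle_monomial d \<sigma> = (\<Prod>s = 1..d. power_sum s ^ cycle_count d s \<sigma>)"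

definition cyclic_index ::
  "nat \<Rightarrow> (nat \<Rightarrow> nat) set \<Rightarrow> ((nat \<Rightarrow> nat) \<Rightarrow> 'a) \<Rightarrow> 'a :: field_char_0 mseries" where
  "cyclic_index d W \<chi> =
     mconst (1 / of_nat (card W)) * (\<Sum>\<sigma>\<in>W. mconst (\<chi> \<sigma>) * cycle_monomial d \<sigma>)"

definition one_dim_characters ::
  "nat \<Rightarrow> (nat \<Rightarrow> nat) set \<Rightarrow> ((nat \<Rightarrow> nat) \<Rightarrow> 'a :: field_char_0) set" where
  "one_dim_characters d W = hom (sym_group d\<lparr>carrier := W\<rparr>) (units_of class_ring)"

definition mat_trace :: "'a :: comm_monoid_add mat \<Rightarrow> 'a" where
  "mat_trace A = (\<Sum>i<dim_row A. A $$ (i, i))"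

text \<open>
  Characters of the finite-dimensional representations of S_d over K, as extensional functions on
  S_d, so that a function in \<open>virtual_characters\<close> is determined by its values on S_d.
\<close>

definition characters :: "nat \<Rightarrow> ((nat \<Rightarrow> nat) \<Rightarrow> 'a :: field_char_0) set" where
  "characters d =
     {\<lambda>\<sigma>\<in>carrier (sym_group d). mat_trace (\<rho> \<sigma>) | \<rho> n.
        \<rho> \<in> hom (sym_group d) (units_of (ring_mat TYPE('a) n ()))}"

definition virtual_characters :: "nat \<Rightarrow> ((nat \<Rightarrow> nat) \<Rightarrow> 'a :: field_char_0) set" where
  "virtual_characters d =
     {\<lambda>\<sigma>\<in>carrier (sym_group d). u \<sigma> - v \<sigma> | u v. u \<in> characters d \<and> v \<in> characters d}"

definition char_map :: "nat \<Rightarrow> ((nat \<Rightarrow> nat) \<Rightarrow> 'a) \<Rightarrow> 'a :: field_char_0 mseries" where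
  "char_map d u =
     mconst (1 / fact d) * (\<Sum>\<sigma>\<in>carrier (sym_group d). mconst (u \<sigma>) * cycle_monomial d \<sigma>)"

text \<open>
  The characteristic map is a bijection from the virtual characters onto the symmetric functions of
  degree d with integer coefficients, here regarded as series over K, which contains the integers.
  The internal product transports the pointwise product along this bijection, and it is meaningful
  only on the image of the virtual characters.
\<close>

definition internal_prod :: "nat \<Rightarrow> 'a mseries \<Rightarrow> 'a mseries \<Rightarrow> 'a :: field_char_0 mseries" where
  "internal_prod d f g =
     (let ch_inv = the_inv_into (virtual_characters d) (char_map d)
      in char_map d (\<lambda>\<sigma>\<in>carrier (sym_group d). ch_inv f \<sigma> * ch_inv g \<sigma>))"

text \<open>\<open>F 1 * ... * F k\<close>, bracketed to the left, for \<open>k \<ge> 1\<close>.\<close>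

definition internal_prod_upto :: "nat \<Rightarrow> (nat \<Rightarrow> 'a mseries) \<Rightarrow> nat \<Rightarrow> 'a :: field_char_0 mseries" where
  "internal_prod_upto d F k = foldl (internal_prod d) (F 1) (map F [2..<Suc k])"


section \<open>Transversals and the action on tuples of coset representatives\<close>

definition left_transversal :: "('a, 'b) monoid_scheme \<Rightarrow> 'a set \<Rightarrow> 'a set \<Rightarrow> bool" where
  "left_transversal G H I \<longleftrightarrow> I \<subseteq> carrier G \<and> (\<forall>C\<in>lcosets\<^bsub>G\<^esub> H. \<exists>!i. i \<in> I \<and> i \<in> C)"

definition coset_action ::
  "('a, 'b) monoid_scheme \<Rightarrow> 'a set \<Rightarrow> 'a set \<Rightarrow> 'a \<Rightarrow> 'a \<Rightarrow> 'a" where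
  "coset_action G H I \<zeta> i = (THE j. j \<in> I \<and> inv\<^bsub>G\<^esub> j \<otimes>\<^bsub>G\<^esub> \<zeta> \<otimes>\<^bsub>G\<^esub> i \<in> H)"

text \<open>Tuples \<open>(i_1, ..., i_k)\<close> are extensional functions on \<open>{1..k}\<close>.\<close>

definition tuple_action ::
  "('a, 'b) monoid_scheme \<Rightarrow> nat \<Rightarrow> (nat \<Rightarrow> 'a set) \<Rightarrow> (nat \<Rightarrow> 'a set) \<Rightarrow>
     'a \<Rightarrow> (nat \<Rightarrow> 'a) \<Rightarrow> (nat \<Rightarrow> 'a)" where
  "tuple_action G k W I \<zeta> =
     (\<lambda>\<omega>\<in>PiE {1..k} I. \<lambda>m\<in>{1..k}. coset_action G (W m) (I m) \<zeta> (\<omega> m))"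

definition orbit_representatives ::
  "('a, 'b) monoid_scheme \<Rightarrow> 'c set \<Rightarrow> ('a \<Rightarrow> 'c \<Rightarrow> 'c) \<Rightarrow> 'c set \<Rightarrow> bool" where
  "orbit_representatives G E \<phi> T \<longleftrightarrow> T \<subseteq> E \<and> (\<forall>Q\<in>orbits G E \<phi>. \<exists>!t. t \<in> T \<and> t \<in> Q)"

definition conjugate_inter ::
  "('a, 'b) monoid_scheme \<Rightarrow> nat \<Rightarrow> (nat \<Rightarrow> 'a set) \<Rightarrow> (nat \<Rightarrow> 'a) \<Rightarrow> 'a set" where
  "conjugate_inter G k W \<omega> = (\<Inter>m\<in>{1..k}. \<omega> m <#\<^bsub>G\<^esub> W m #>\<^bsub>G\<^esub> inv\<^bsub>G\<^esub> (\<omega> m))"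

definition beta ::
  "('a, 'b) monoid_scheme \<Rightarrow> nat \<Rightarrow> (nat \<Rightarrow> 'a set) \<Rightarrow> (nat \<Rightarrow> 'a \<Rightarrow> 'c) \<Rightarrow> (nat \<Rightarrow> 'a set) \<Rightarrow>
     (nat \<Rightarrow> 'a) \<Rightarrow> 'a \<Rightarrow> 'c :: comm_monoid_mult" where
  "beta G k W \<chi> I \<omega> \<zeta> =
     (\<Prod>m = 1..k. \<chi> m (inv\<^bsub>G\<^esub> (coset_action G (W m) (I m) \<zeta> (\<omega> m)) \<otimes>\<^bsub>G\<^esub> \<zeta> \<otimes>\<^bsub>G\<^esub> \<omega> m))"

definition psi ::
  "('a, 'b) monoid_scheme \<Rightarrow> nat \<Rightarrow> (nat \<Rightarrow> 'a set) \<Rightarrow> (nat \<Rightarrow> 'a \<Rightarrow> 'c) \<Rightarrow> (nat \<Rightarrow> 'a set) \<Rightarrow>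
     (nat \<Rightarrow> 'a) \<Rightarrow> 'a \<Rightarrow> 'c :: comm_monoid_mult" where
  "psi G k W \<chi> I \<omega> = restrict (beta G k W \<chi> I \<omega>) (conjugate_inter G k W \<omega>)"

end

theory Submission
  imports Defs
begin

text \<open>
  The coefficient of a monomial in the cycle monomial of \<open>\<sigma>\<close> counts the colourings of \<open>{1..d}\<close> with
  prescribed content that \<open>\<sigma>\<close> preserves. Hence a class function killed by the characteristic map sums
  to zero over the stabilizer of every colouring, and it vanishes by induction on the number of
  cycles; so the characteristic map is injective on virtual characters. The characters induced from
  the \<open>\<chi>\<^sub>m\<close> are characters of monomial representations on \<open>I\<^sub>m\<close>, and their product is the character
  of the monomial representation on \<open>I\<close> with cocycle \<open>\<beta>\<close>. Averaging that character over \<open>S\<^sub>d\<close> and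
  grouping by orbits with the orbit-stabilizer theorem yields the sum over \<open>T\<close>.
\<close>

section \<open>Coefficients of cycle monomials\<close>

text \<open>\<open>internal_prod\<close> reads its arguments back through
  \<open>the_inv_into\<close>, so nothing can be said about a product of series before
  \<open>char_map\<close> is known to be injective on virtual characters. Irreducible characters and
  Schur functions are avoided: injectivity only needs that virtual characters are class functions,
  and for these the coefficients of \<open>char_map\<close> are, up to the factor
  \<open>1 / fact d\<close>, sums against the permutation characters on colourings. One orbit
  computation then serves twice. On \<open>I m\<close> the action is transitive, and the computation
  identifies the cyclic index with the characteristic of the induced character. On tuples there may
  be several orbits, and it produces the right-hand side. The link is that a tuple is fixed exactly
  when each of its coordinates is, so the diagonal sums multiply. Every partial product is again the
  character of a monomial representation, hence stays in the range where the internal product is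
  meaningful.\<close>

lemma mcoeff_add: "mcoeff (f + g) M = mcoeff f M + mcoeff g M"
  by (simp add: plus_mseries_def)

lemma mcoeff_sum: "mcoeff (\<Sum>x\<in>A. f x) M = (\<Sum>x\<in>A. mcoeff (f x) M)"
  by (induction A rule: infinite_finite_induct) (simp_all add: mcoeff_add zero_mseries_def)

lemma mcoeff_mconst_mult: "mcoeff (mconst c * f) M = c * mcoeff f M"
proof -
  have "mcoeff (mconst c * f) M =
      (\<Sum>(A, B)\<in>{(A, B). A + B = M}. (if A = {#} then c else 0) * mcoeff f B)"
    by (simp add: times_mseries_def mconst_def)
  also have "\<dots> = (\<Sum>(A, B)\<in>{({#} :: nat multiset, M)}. (if A = {#} then c else 0) * mcoeff f B)"
    by (rule sum.mono_neutral_right[OF finite_mset_splits]) (auto split: if_splits)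
  finally show ?thesis by simp
qed

text \<open>A positive weight makes every colour used by \<open>g\<close> occur in \<open>M\<close>,
  which leaves finitely many colours per point; a point of weight zero could take any
  colour.\<close>

lemma finite_weighted_colorings:
  assumes "finite P" "\<And>x. x \<in> P \<Longrightarrow> n x > 0"
  shows "finite {g \<in> P \<rightarrow>\<^sub>E UNIV. (\<Sum>x\<in>P. replicate_mset (n x) (g x)) = M}" (is "finite ?G")
proof (rule finite_subset)
  show "?G \<subseteq> (P \<rightarrow>\<^sub>E set_mset M)"
  proof clarify
    fix g x assume g: "g \<in> P \<rightarrow>\<^sub>E UNIV"
    have "g x \<in># (\<Sum>x\<in>P. replicate_mset (n x) (g x))" if "x \<in> P" for x
      using that assms by (auto simp: set_mset_sum)
    then show "g \<in> P \<rightarrow>\<^sub>E set_mset (\<Sum>x\<in>P. replicate_mset (n x) (g x))"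
      using g by (auto simp: PiE_iff)
  qed
  show "finite (P \<rightarrow>\<^sub>E set_mset M)"
    using assms(1) by (intro finite_PiE) auto
qed

text \<open>Expanding the product means picking one term from each factor, and a term of
  \<open>power_sum (n x)\<close> is the choice of a colour for \<open>x\<close>, counted with
  multiplicity \<open>n x\<close>.\<close>

lemma mcoeff_prod_power_sum:
  assumes "finite P" "\<And>x. x \<in> P \<Longrightarrow> n x > 0"
  shows "mcoeff (\<Prod>x\<in>P. power_sum (n x) :: 'b :: comm_ring_1 mseries) M =
    of_nat (card {g \<in> P \<rightarrow>\<^sub>E UNIV. (\<Sum>x\<in>P. replicate_mset (n x) (g x)) = M})"
  using assms
proof (induction P arbitrary: M rule: finite_induct)
  case empty
  show ?case by (auto simp: one_mseries_def)
next
  case (insert a P)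
  define G where "G = (\<lambda>P (M :: nat multiset). {g \<in> P \<rightarrow>\<^sub>E UNIV. (\<Sum>x\<in>P. replicate_mset (n x) (g x)) = M})"
  let ?S = "{(A, B). A + B = M \<and> (\<exists>i. A = replicate_mset (n a) i)}"
  have na: "n a > 0" using insert.prems by simp
  have finS: "finite ?S"
    by (rule finite_subset[OF _ finite_mset_splits[of M]]) auto
  have finG: "finite (G P B)" for B
    unfolding G_def using insert.prems insert.hyps by (intro finite_weighted_colorings) auto
  have "mcoeff (\<Prod>x\<in>insert a P. power_sum (n x) :: 'b mseries) M =
      (\<Sum>(A, B)\<in>{(A, B). A + B = M}. (if \<exists>i. A = replicate_mset (n a) i then 1 else 0) *
         mcoeff (\<Prod>x\<in>P. power_sum (n x) :: 'b mseries) B)"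
    using insert.hyps by (simp add: times_mseries_def power_sum_def)
  also have "\<dots> = (\<Sum>(A, B)\<in>?S. mcoeff (\<Prod>x\<in>P. power_sum (n x) :: 'b mseries) B)"
    by (rule sum.mono_neutral_cong_right[OF finite_mset_splits]) (auto split: if_splits)
  also have "\<dots> = (\<Sum>(A, B)\<in>?S. of_nat (card (G P B)))"
    using insert.IH insert.prems by (simp add: G_def)
  also have "\<dots> = of_nat (card (SIGMA (A, B):?S. G P B))"
    using finS finG by (subst card_SigmaI) (auto simp: case_prod_unfold)
  also have "card (SIGMA (A, B):?S. G P B) = card (G (insert a P) M)"
  proof (rule bij_betw_same_card[OF bij_betw_byWitness])
    \<comment> \<open>Since \<open>n a > 0\<close>, the multiset \<open>A\<close> is nonempty and
      its only element is the colour of \<open>a\<close>.\<close>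
    let ?f = "\<lambda>((A, B), g). g(a := the_elem (set_mset A))"
    let ?f' = "\<lambda>g. ((replicate_mset (n a) (g a), M - replicate_mset (n a) (g a)), restrict g P)"
    have *: "(\<Sum>x\<in>P. replicate_mset (n x) (if x = a then i else g x)) = (\<Sum>x\<in>P. replicate_mset (n x) (g x))" for g i
      using insert.hyps by (intro sum.cong) auto
    show "\<forall>z\<in>(SIGMA (A, B):?S. G P B). ?f' (?f z) = z"
      using na insert.hyps by (auto simp: G_def fun_eq_iff PiE_def extensional_def)
    show "\<forall>g\<in>G (insert a P) M. ?f (?f' g) = g"
      using na insert.hyps by (auto simp: G_def fun_eq_iff PiE_def extensional_def)
    show "?f ` (SIGMA (A, B):?S. G P B) \<subseteq> G (insert a P) M"
      using na insert.hyps by (auto simp: G_def PiE_def extensional_def *)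
    show "?f' ` G (insert a P) M \<subseteq> (SIGMA (A, B):?S. G P B)"
      using na insert.hyps by (auto simp: G_def)
  qed
  finally show ?case by (simp add: G_def)
qed

section \<open>Cycles of a permutation and invariant colourings\<close>

lemma cycles_eq_orbits:
  assumes "\<sigma> permutes S" "finite S"
  shows "{C. C \<subseteq> S \<and> cyclic_on \<sigma> C} = Orbits.orbit \<sigma> ` S"
proof -
  show ?thesis
    using permutes_orbit_subset[OF assms(1)] cyclic_on_orbit[OF assms]
    by (auto simp: cyclic_on_def)
qed

lemma mem_orbit_self: "\<sigma> permutes S \<Longrightarrow> finite S \<Longrightarrow> x \<in> Orbits.orbit \<sigma> x"
  by (auto intro!: permutation_self_in_orbit simp: permutation_permutes)

lemma orbit_eq_of_mem:
  assumes "\<sigma> permutes S" "finite S" "y \<in> Orbits.orbit \<sigma> x"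
  shows "Orbits.orbit \<sigma> y = Orbits.orbit \<sigma> x"
  using cyclic_on_orbit[OF assms(1,2)] assms(3) by (rule orbit_cyclic_eq3)

lemma cycle_monomial_eq_prod_orbits:
  assumes "\<sigma> permutes {1..d}"
  shows "cycle_monomial d \<sigma> =
    (\<Prod>C\<in>Orbits.orbit \<sigma> ` {1..d}. power_sum (card C) :: 'a :: comm_ring_1 mseries)"
proof -
  let ?O = "Orbits.orbit \<sigma> ` {1..d}"
  \<comment> \<open>No cycle is lost, or sent to the meaningless exponent 0, when cycles are grouped
    by the lengths \<open>1..d\<close>.\<close>
  have "card C \<in> {1..d}" if "C \<in> ?O" for C
  proof -
    have "C \<subseteq> {1..d}" "C \<noteq> {}" using that permutes_orbit_subset[OF assms] orbit_nonempty by fast+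
    moreover have "finite C" using calculation(1) finite_subset by blast
    ultimately show ?thesis
      using card_mono[of "{1..d}" C] by (auto simp: Suc_le_eq card_gt_0_iff)
  qed
  then have "(\<Prod>C\<in>?O. power_sum (card C) :: 'a mseries) =
      (\<Prod>s = 1..d. \<Prod>C\<in>{C \<in> ?O. card C = s}. power_sum (card C))"
    by (subst prod.group) auto
  also have "\<dots> = (\<Prod>s = 1..d. power_sum s ^ cycle_count d s \<sigma>)"
  proof (rule prod.cong[OF refl])
    fix s
    have "{C \<in> ?O. card C = s} = {C. C \<subseteq> {1..d} \<and> cyclic_on \<sigma> C \<and> card C = s}"
      using cycles_eq_orbits[OF assms] by auto
    then show "(\<Prod>C\<in>{C \<in> ?O. card C = s}. power_sum (card C) :: 'a mseries) = power_sum s ^ cycle_count d s \<sigma>"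
      by (simp add: cycle_count_def)
  qed
  finally show ?thesis by (simp add: cycle_monomial_def)
qed

text \<open>\<open>M\<close> is the content of the colouring, i.e. a monomial. Extensionality keeps
  the set finite, and it costs nothing for invariance, because a permutation of \<open>S\<close>
  fixes every point outside \<open>S\<close>.\<close>

definition colorings :: "'a set \<Rightarrow> nat multiset \<Rightarrow> ('a \<Rightarrow> nat) set" where
  "colorings S M = {f \<in> S \<rightarrow>\<^sub>E UNIV. image_mset f (mset_set S) = M}"

lemma finite_colorings:
  assumes "finite S"
  shows "finite (colorings S M)"
proof (rule finite_subset)
  show "colorings S M \<subseteq> (S \<rightarrow>\<^sub>E set_mset M)"
    using assms by (auto simp: colorings_def PiE_def)
qed (use assms in \<open>auto intro: finite_PiE\<close>)

lemma sum_single_mset: "(\<Sum>x\<in>A. {#c#}) = replicate_mset (card A) c"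
  by (induction A rule: infinite_finite_induct) simp_all

text \<open>A colouring preserved by \<open>\<sigma>\<close> is constant on cycles, so it is a
  choice of one colour per cycle, and a cycle \<open>C\<close> contributes \<open>card C\<close>
  copies of its colour to the content.\<close>

lemma mcoeff_cycle_monomial:
  assumes "\<sigma> permutes {1..d}"
  shows "mcoeff (cycle_monomial d \<sigma>) M = of_nat (card {f \<in> colorings {1..d} M. f \<circ> \<sigma> = f})"
proof -
  let ?S = "{1..d}" and ?o = "Orbits.orbit \<sigma>"
  note self = mem_orbit_self[OF assms finite_atLeastAtMost]
  note eq = orbit_eq_of_mem[OF assms finite_atLeastAtMost]
  note sub = permutes_orbit_subset[OF assms]
  have "mcoeff (cycle_monomial d \<sigma>) M = of_nat (card {g \<in> ?o ` ?S \<rightarrow>\<^sub>E UNIV.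
      (\<Sum>C\<in>?o ` ?S. replicate_mset (card C) (g C)) = M})"
    unfolding cycle_monomial_eq_prod_orbits[OF assms]
  proof (rule mcoeff_prod_power_sum)
    fix C assume "C \<in> ?o ` ?S"
    then have "C \<subseteq> ?S" "C \<noteq> {}" using sub orbit_nonempty by fast+
    then show "card C > 0" using finite_subset by (auto simp: card_gt_0_iff)
  qed simp
  also have "card {g \<in> ?o ` ?S \<rightarrow>\<^sub>E UNIV. (\<Sum>C\<in>?o ` ?S. replicate_mset (card C) (g C)) = M} =
      card {f \<in> colorings ?S M. f \<circ> \<sigma> = f}" (is "card ?A = card ?B")
  proof -
    \<comment> \<open>A colouring of cycles is pulled back to points; conversely an invariant
      colouring is read off at an arbitrarily chosen point of each cycle.\<close>
    let ?f = "\<lambda>g :: nat set \<Rightarrow> nat. \<lambda>x\<in>?S. g (?o x)"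
    let ?f' = "\<lambda>f :: nat \<Rightarrow> nat. \<lambda>C\<in>?o ` ?S. f (SOME x. x \<in> C)"
    have some: "(SOME y. y \<in> ?o x) \<in> ?o x" for x
      using self by (rule someI)
    have someS: "(SOME y. y \<in> ?o x) \<in> ?S" if "x \<in> ?S" for x
      using some[of x] sub[OF that] by blast
    have const: "f y = f x" if "f \<circ> \<sigma> = f" "y \<in> ?o x" for f :: "nat \<Rightarrow> nat" and x y
      using that(2) by induction (use that(1) in \<open>auto simp: fun_eq_iff\<close>)
    have content: "image_mset f (mset_set ?S) = (\<Sum>C\<in>?o ` ?S. replicate_mset (card C) (g C))"
      if "\<And>x. x \<in> ?S \<Longrightarrow> f x = g (?o x)" for f g :: "_ \<Rightarrow> nat"
    proof -
      have "image_mset f (mset_set ?S) = (\<Sum>x\<in>?S. {#f x#})"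
        by (simp add: sum_unfold_sum_mset)
      also have "\<dots> = (\<Sum>C\<in>?o ` ?S. \<Sum>x\<in>{x \<in> ?S. ?o x = C}. {#f x#})"
        by (rule sum.group[symmetric]) auto
      also have "\<dots> = (\<Sum>C\<in>?o ` ?S. replicate_mset (card C) (g C))"
      proof (rule sum.cong[OF refl])
        fix C assume "C \<in> ?o ` ?S"
        then have "{x \<in> ?S. ?o x = C} = C"
          using self eq sub by blast
        moreover have "(\<Sum>x\<in>{x \<in> ?S. ?o x = C}. {#f x#}) = (\<Sum>x\<in>{x \<in> ?S. ?o x = C}. {#g C#})"
          using that by (intro sum.cong) auto
        ultimately show "(\<Sum>x\<in>{x \<in> ?S. ?o x = C}. {#f x#}) = replicate_mset (card C) (g C)"
          by (simp add: sum_single_mset)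
      qed
      finally show ?thesis .
    qed
    have "\<forall>g\<in>?A. ?f' (?f g) = g"
    proof
      fix g assume "g \<in> ?A"
      then have ext: "g \<in> ?o ` ?S \<rightarrow>\<^sub>E UNIV" by simp
      show "?f' (?f g) = g"
      proof
        fix C show "?f' (?f g) C = g C"
        proof (cases "C \<in> ?o ` ?S")
          case True
          then obtain x where "x \<in> ?S" "C = ?o x" by blast
          then show ?thesis using someS[of x] eq[OF some[of x]] by auto
        next
          case False
          then show ?thesis using ext by (auto simp: PiE_def extensional_def)
        qed
      qed
    qed
    moreover have "\<forall>f\<in>?B. ?f (?f' f) = f"
    proof
      fix f assume "f \<in> ?B"
      then have ext: "f \<in> ?S \<rightarrow>\<^sub>E UNIV" and fx: "f \<circ> \<sigma> = f" by (auto simp: colorings_def)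
      show "?f (?f' f) = f"
      proof
        fix x show "?f (?f' f) x = f x"
          using const[OF fx some] ext by (auto simp: PiE_def extensional_def)
      qed
    qed
    moreover have "?f ` ?A \<subseteq> ?B"
    proof (rule image_subsetI)
      fix g assume "g \<in> ?A"
      have "?f g (\<sigma> x) = ?f g x" for x
        using permutes_in_image[OF assms, of x] eq[OF orbit.base, of x]
        by auto
      then show "?f g \<in> ?B" using \<open>g \<in> ?A\<close> content[of "?f g" g]
        by (auto simp: colorings_def fun_eq_iff)
    qed
    moreover have "?f' ` ?B \<subseteq> ?A"
    proof (rule image_subsetI)
      fix f assume "f \<in> ?B"
      then have "f x = ?f' f (?o x)" if "x \<in> ?S" for x
        using const[OF _ some, of f] that by auto
      then show "?f' f \<in> ?A" using \<open>f \<in> ?B\<close> content[of f "?f' f"]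
        by (auto simp: colorings_def)
    qed
    ultimately show ?thesis
      by (rule bij_betw_same_card[OF bij_betw_byWitness])
  qed
  finally show ?thesis .
qed

section \<open>Class functions and colourings\<close>

text \<open>The period of \<open>b\<close> is the size of its orbit. Hence which powers of
  \<open>f\<close> agree at \<open>b\<close> depends on that size alone, which allows a comparison
  of two permutations with a common cycle.\<close>

lemma funpow_eq_iff_mod_card_orbit:
  assumes "b \<in> Orbits.orbit f b"
  shows "(f ^^ i) b = (f ^^ j) b \<longleftrightarrow>
    i mod card (Orbits.orbit f b) = j mod card (Orbits.orbit f b)"
proof -
  let ?n = "funpow_dist1 f b b"
  have inj: "inj_on (\<lambda>i. (f ^^ i) b) {0..<?n}"
    using assms by (rule inj_on_funpow_dist1)
  have n: "card (Orbits.orbit f b) = ?n"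
    by (subst orbit_conv_funpow_dist1[OF assms]) (simp add: card_image[OF inj])
  have "(f ^^ ?n) b = b" using assms by (rule funpow_dist1_prop)
  then have "(f ^^ i) b = (f ^^ (i mod ?n)) b" for i
    by (metis funpow_mod_eq)
  then have "(f ^^ i) b = (f ^^ j) b \<longleftrightarrow> (f ^^ (i mod ?n)) b = (f ^^ (j mod ?n)) b"
    by simp
  also have "\<dots> \<longleftrightarrow> i mod ?n = j mod ?n"
    using inj by (auto dest!: inj_onD)
  finally show ?thesis using n by simp
qed

text \<open>Choose a base point in each common cycle and send its \<open>i\<close>-th iterate under
  \<open>\<sigma>\<close> to its \<open>i\<close>-th iterate under \<open>\<tau>\<close>. This is
  consistent because both permutations have the same period there.\<close>

lemma conjugate_if_same_orbits:
  assumes S: "finite S" and \<sigma>: "\<sigma> permutes S" and \<tau>: "\<tau> permutes S"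
    and same: "\<And>x. Orbits.orbit \<sigma> x = Orbits.orbit \<tau> x"
  obtains g where "g permutes S" "g \<circ> \<sigma> = \<tau> \<circ> g"
proof -
  let ?o = "Orbits.orbit \<sigma>"
  note self = mem_orbit_self[OF \<sigma> S] and eq = orbit_eq_of_mem[OF \<sigma> S]
  define b where "b x = (SOME y. y \<in> ?o x)" for x
  define n where "n x = funpow_dist \<sigma> (b x) x" for x
  define g where "g x = (\<tau> ^^ n x) (b x)" for x
  have b_mem: "b x \<in> ?o x" for x
    unfolding b_def using self by (rule someI)
  have ob: "?o (b x) = ?o x" for x
    using eq[OF b_mem] .
  have b_eq: "b x = b y" if "?o x = ?o y" for x y
    using that by (simp add: b_def)
  have n: "(\<sigma> ^^ n x) (b x) = x" for x
    unfolding n_def by (rule funpow_dist_prop) (use ob self in auto)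
  \<comment> \<open>Both permutations have the same orbit through \<open>b x\<close>, hence the same
    period at \<open>b x\<close>.\<close>
  have transfer: "(\<sigma> ^^ i) (b x) = (\<sigma> ^^ j) (b x) \<longleftrightarrow> (\<tau> ^^ i) (b x) = (\<tau> ^^ j) (b x)" for i j x
    using funpow_eq_iff_mod_card_orbit[of "b x" \<sigma> i j] funpow_eq_iff_mod_card_orbit[of "b x" \<tau> i j]
      self same by simp
  have g_mem: "g x \<in> ?o x" for x
    unfolding g_def using ob same funpow_in_orbit[OF self[of "b x", unfolded same]] by metis
  have "inj g"
  proof (rule injI)
    fix x y assume "g x = g y"
    then have "?o x = ?o y" using g_mem eq by metis
    then have "b x = b y" by (rule b_eq)
    then show "x = y"
      using \<open>g x = g y\<close> transfer n unfolding g_def by metis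
  qed
  have "g permutes S"
  proof (rule bij_imp_permutes)
    show "g x = x" if "x \<notin> S" for x
    proof -
      have "\<sigma> x = x" using \<sigma> that by (simp add: permutes_not_in)
      then have "?o x = {x}" by (simp add: orbit_eq_singleton_iff)
      then show ?thesis using g_mem[of x] by simp
    qed
    have "g ` S \<subseteq> S" using g_mem permutes_orbit_subset[OF \<sigma>] by blast
    then show "bij_betw g S S"
      using S \<open>inj g\<close> by (simp add: bij_betw_def endo_inj_surj inj_on_subset[OF _ subset_UNIV])
  qed
  moreover have "g \<circ> \<sigma> = \<tau> \<circ> g"
  proof
    fix x
    have "b (\<sigma> x) = b x" by (intro b_eq eq orbit.base)
    moreover have "(\<sigma> ^^ n (\<sigma> x)) (b (\<sigma> x)) = (\<sigma> ^^ Suc (n x)) (b x)"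
      using n by simp
    ultimately have "(\<tau> ^^ n (\<sigma> x)) (b x) = (\<tau> ^^ Suc (n x)) (b x)"
      using transfer by metis
    then show "(g \<circ> \<sigma>) x = (\<tau> \<circ> g) x"
      using \<open>b (\<sigma> x) = b x\<close> by (simp add: g_def)
  qed
  ultimately show thesis by (rule that)
qed

section \<open>Colourings of fixed content and class functions\<close>

lemma comp_permutation_mem_colorings:
  assumes "p permutes S" "f \<in> colorings S M"
  shows "f \<circ> p \<in> colorings S M"
proof -
  have "image_mset (f \<circ> p) (mset_set S) = image_mset f (mset_set S)"
    using permutes_inj_on[OF assms(1), of S] permutes_image[OF assms(1)]
    by (metis image_mset_mset_set multiset.map_comp)
  then show ?thesis
    using assms by (auto simp: colorings_def PiE_def extensional_def permutes_not_in)
qed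

lemma colorings_transitive:
  assumes "finite S" "f \<in> colorings S M" "f' \<in> colorings S M"
  obtains p where "p permutes S" "f = f' \<circ> p"
proof -
  obtain p where p: "p permutes S" "\<forall>x\<in>S. f x = f' (p x)"
    using image_mset_eq_implies_permutes[OF assms(1), of f f'] assms(2,3)
    by (auto simp: colorings_def)
  have "f x = f' (p x)" for x
    using p assms(2,3) by (cases "x \<in> S") (auto simp: colorings_def PiE_def extensional_def permutes_not_in)
  then show thesis using p(1) that by (simp add: fun_eq_iff)
qed

text \<open>Conjugacy is written as an intertwining equation, so that no inverse of \<open>g\<close>
  has to be handled.\<close>

definition class_function :: "'a set \<Rightarrow> (('a \<Rightarrow> 'a) \<Rightarrow> 'b) \<Rightarrow> bool" where
  "class_function S u \<longleftrightarrow> (\<forall>\<sigma> \<tau> g. \<sigma> permutes S \<longrightarrow> \<tau> permutes S \<longrightarrow> g permutes S \<longrightarrow>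
     g \<circ> \<sigma> = \<tau> \<circ> g \<longrightarrow> u \<sigma> = u \<tau>)"

lemma class_functionD:
  "class_function S u \<Longrightarrow> \<sigma> permutes S \<Longrightarrow> \<tau> permutes S \<Longrightarrow> g permutes S \<Longrightarrow>
    g \<circ> \<sigma> = \<tau> \<circ> g \<Longrightarrow> u \<sigma> = u \<tau>"
  unfolding class_function_def by blast

text \<open>Composition with \<open>inv' g\<close> carries the colourings preserved by
  \<open>\<sigma>\<close> to those preserved by \<open>\<tau>\<close>.\<close>

lemma card_fixed_colorings_class_function:
  "class_function S (\<lambda>\<sigma>. card {f \<in> colorings S M. f \<circ> \<sigma> = f})"
  unfolding class_function_def
proof (intro allI impI)
  fix \<sigma> \<tau> g assume \<sigma>: "\<sigma> permutes S" and \<tau>: "\<tau> permutes S" and g: "g permutes S"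
    and conj: "g \<circ> \<sigma> = \<tau> \<circ> g"
  note inv = permutes_inv_o[OF g]
  have conj': "\<sigma> \<circ> inv' g = inv' g \<circ> \<tau>"
    using conj inv by (metis comp_assoc comp_id id_comp)
  show "card {f \<in> colorings S M. f \<circ> \<sigma> = f} = card {f \<in> colorings S M. f \<circ> \<tau> = f}"
  proof (rule bij_betw_same_card[OF bij_betw_byWitness
        [where f = "\<lambda>f. f \<circ> inv' g" and f' = "\<lambda>f. f \<circ> g"]])
    show "\<forall>f\<in>{f \<in> colorings S M. f \<circ> \<sigma> = f}. (f \<circ> inv' g) \<circ> g = f"
      by (simp add: comp_assoc inv)
    show "\<forall>f\<in>{f \<in> colorings S M. f \<circ> \<tau> = f}. (f \<circ> g) \<circ> inv' g = f"
      by (simp add: comp_assoc inv)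
    show "(\<lambda>f. f \<circ> inv' g) ` {f \<in> colorings S M. f \<circ> \<sigma> = f} \<subseteq> {f \<in> colorings S M. f \<circ> \<tau> = f}"
      using comp_permutation_mem_colorings[OF permutes_inv[OF g]]
      by (auto simp: comp_assoc conj'[symmetric]) (metis comp_assoc)
    show "(\<lambda>f. f \<circ> g) ` {f \<in> colorings S M. f \<circ> \<tau> = f} \<subseteq> {f \<in> colorings S M. f \<circ> \<sigma> = f}"
      using comp_permutation_mem_colorings[OF g]
      by (auto simp: comp_assoc conj) (metis comp_assoc)
  qed
qed

lemma conj_permutes:
  assumes "p permutes S" "\<sigma> permutes S"
  shows "p \<circ> \<sigma> \<circ> inv' p permutes S" "p \<circ> \<sigma> = (p \<circ> \<sigma> \<circ> inv' p) \<circ> p"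
proof -
  show "p \<circ> \<sigma> \<circ> inv' p permutes S"
    using assms by (intro permutes_compose permutes_inv)
  show "p \<circ> \<sigma> = (p \<circ> \<sigma> \<circ> inv' p) \<circ> p"
    using permutes_inv_o[OF assms(1)] by (simp add: comp_assoc)
qed

text \<open>The permutations of \<open>S\<close> act transitively on the colourings of a given
  content, so the stabilizers are conjugate Young subgroups, and a class function does not
  distinguish them.\<close>

lemma sum_stabilizer_coloring_eq:
  fixes w :: "('a \<Rightarrow> 'a) \<Rightarrow> 'b :: comm_monoid_add"
  assumes S: "finite S" and w: "class_function S w" and f: "f \<in> colorings S M" "f' \<in> colorings S M"
  shows "(\<Sum>\<sigma> | \<sigma> permutes S \<and> f \<circ> \<sigma> = f. w \<sigma>) = (\<Sum>\<sigma> | \<sigma> permutes S \<and> f' \<circ> \<sigma> = f'. w \<sigma>)"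
proof -
  obtain p where p: "p permutes S" "f = f' \<circ> p"
    using colorings_transitive[OF S f] .
  note inv = permutes_inv_o[OF p(1)]
  have p': "f' = f \<circ> inv' p" using p inv by (simp add: comp_assoc)
  show ?thesis
  proof (rule sum.reindex_bij_witness[where i = "\<lambda>\<sigma>. inv' p \<circ> \<sigma> \<circ> p" and j = "\<lambda>\<sigma>. p \<circ> \<sigma> \<circ> inv' p"])
    fix \<sigma> assume \<sigma>: "\<sigma> \<in> {\<sigma>. \<sigma> permutes S \<and> f \<circ> \<sigma> = f}"
    show "inv' p \<circ> (p \<circ> \<sigma> \<circ> inv' p) \<circ> p = \<sigma>"
      using inv by (metis comp_assoc comp_id id_comp)
    have "f' \<circ> (p \<circ> \<sigma> \<circ> inv' p) = f'"
      using \<sigma> p' by (metis (mono_tags, lifting) comp_assoc mem_Collect_eq p(2))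
    then show "p \<circ> \<sigma> \<circ> inv' p \<in> {\<sigma>. \<sigma> permutes S \<and> f' \<circ> \<sigma> = f'}"
      using conj_permutes[OF p(1)] \<sigma> by simp
    show "w (p \<circ> \<sigma> \<circ> inv' p) = w \<sigma>"
      using class_functionD[OF w, of \<sigma> _ p] conj_permutes[OF p(1), of \<sigma>] \<sigma> p(1) by simp
  next
    fix \<sigma> assume \<sigma>: "\<sigma> \<in> {\<sigma>. \<sigma> permutes S \<and> f' \<circ> \<sigma> = f'}"
    show "p \<circ> (inv' p \<circ> \<sigma> \<circ> p) \<circ> inv' p = \<sigma>"
      using inv by (metis comp_assoc comp_id id_comp)
    have "f \<circ> (inv' p \<circ> \<sigma> \<circ> p) = f"
      using \<sigma> p' by (metis (mono_tags, lifting) comp_assoc mem_Collect_eq p(2))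
    then show "inv' p \<circ> \<sigma> \<circ> p \<in> {\<sigma>. \<sigma> permutes S \<and> f \<circ> \<sigma> = f}"
      using p(1) \<sigma> by (auto intro: permutes_compose permutes_inv)
  qed
qed

text \<open>Sending each cycle of \<open>\<tau>\<close> to the cycle of \<open>\<sigma>\<close>
  containing it is onto; it is not injective, because the cycle of \<open>\<sigma>\<close> through
  \<open>x\<close> breaks into several. The strict inequality drives the induction on the number of
  cycles.\<close>

lemma card_orbits_less_if_refines:
  assumes S: "finite S" and \<sigma>: "\<sigma> permutes S" and \<tau>: "\<tau> permutes S"
    and sub: "\<And>x. Orbits.orbit \<tau> x \<subseteq> Orbits.orbit \<sigma> x"
    and ne: "Orbits.orbit \<tau> x \<noteq> Orbits.orbit \<sigma> x"
  shows "card (Orbits.orbit \<sigma> ` S) < card (Orbits.orbit \<tau> ` S)"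
proof -
  let ?h = "\<lambda>C. \<Union> (Orbits.orbit \<sigma> ` C)"
  have h: "?h (Orbits.orbit \<tau> y) = Orbits.orbit \<sigma> y" for y
    using orbit_eq_of_mem[OF \<sigma> S] sub orbit_nonempty[of \<tau> y] by blast
  then have im: "?h ` Orbits.orbit \<tau> ` S = Orbits.orbit \<sigma> ` S"
    by (simp add: image_image)
  have "\<not> inj_on ?h (Orbits.orbit \<tau> ` S)"
  proof
    assume inj: "inj_on ?h (Orbits.orbit \<tau> ` S)"
    obtain y where y: "y \<in> Orbits.orbit \<sigma> x" "y \<notin> Orbits.orbit \<tau> x"
      using sub ne by blast
    have "x \<in> S"
    proof (rule ccontr)
      assume "x \<notin> S"
      then have "\<sigma> x = x" "\<tau> x = x" using \<sigma> \<tau> by (simp_all add: permutes_not_in)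
      then show False using ne by (metis orbit_eq_singleton_iff)
    qed
    then have "y \<in> S" using y(1) permutes_orbit_subset[OF \<sigma>] by blast
    have "?h (Orbits.orbit \<tau> x) = ?h (Orbits.orbit \<tau> y)"
      using h orbit_eq_of_mem[OF \<sigma> S y(1)] by simp
    then have "Orbits.orbit \<tau> x = Orbits.orbit \<tau> y"
      by (rule inj_onD[OF inj]) (simp_all add: \<open>x \<in> S\<close> \<open>y \<in> S\<close>)
    then show False using mem_orbit_self[OF \<tau> S] y(2) by blast
  qed
  then have "card (?h ` Orbits.orbit \<tau> ` S) \<noteq> card (Orbits.orbit \<tau> ` S)"
    using S by (metis finite_imageI eq_card_imp_inj_on)
  then show ?thesis
    using card_image_le[of "Orbits.orbit \<tau> ` S" ?h] S im by simp
qed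

text \<open>
  Colouring the points by the cycles of \<open>\<sigma>\<close> isolates, among the permutations preserving the colouring,
  those with the same cycles as \<open>\<sigma>\<close> and others with strictly more cycles.
\<close>

lemma class_function_eq_zero:
  fixes w :: "(nat \<Rightarrow> nat) \<Rightarrow> 'b :: field_char_0"
  assumes S: "finite S" and w: "class_function S w"
    and zero: "\<And>M. (\<Sum>\<sigma> | \<sigma> permutes S. w \<sigma> * of_nat (card {f \<in> colorings S M. f \<circ> \<sigma> = f})) = 0"
    and "\<sigma> permutes S"
  shows "w \<sigma> = 0"
  using \<open>\<sigma> permutes S\<close>
\<comment> \<open>The number of cycles is at most \<open>card S\<close>, so this natural-number
  difference really drops when the number of cycles grows.\<close>
proof (induction "card S - card (Orbits.orbit \<sigma> ` S)" arbitrary: \<sigma> rule: less_induct)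
  case less
  note \<sigma> = less.prems
  let ?o = "Orbits.orbit \<sigma>"
  note self = mem_orbit_self[OF \<sigma> S] and eq = orbit_eq_of_mem[OF \<sigma> S]
  have finP: "finite {\<tau>. \<tau> permutes S}"
    using S by (rule finite_permutations)
  \<comment> \<open>Each point is coloured by a chosen point of its own cycle. The points are
    natural numbers, hence usable as colours, and distinct cycles get distinct colours.\<close>
  define f where "f = restrict (\<lambda>x. SOME y. y \<in> ?o x) S"
  define M where "M = image_mset f (mset_set S)"
  define A where "A = {\<tau>. \<tau> permutes S \<and> f \<circ> \<tau> = f}"
  have finA: "finite A"
    unfolding A_def by (rule finite_subset[OF _ finP]) auto
  have some: "(SOME y. y \<in> ?o x) \<in> ?o x" for x
    using self by (rule someI)
  have f_inj: "?o x = ?o y" if "f x = f y" "x \<in> S" "y \<in> S" for x y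
    using that eq[OF some] unfolding f_def by (metis restrict_apply')
  have f_mem: "f \<in> colorings S M"
    by (simp add: colorings_def M_def f_def)
  have "\<sigma> \<in> A"
  proof -
    have "f (\<sigma> x) = f x" for x
      using eq[OF orbit.base[of \<sigma> x]] permutes_in_image[OF \<sigma>, of x] permutes_not_in[OF \<sigma>, of x]
      by (simp add: f_def)
    then show ?thesis using \<sigma> by (simp add: A_def fun_eq_iff)
  qed
  \<comment> \<open>Double counting of the pairs of a permutation and a colouring of content
    \<open>M\<close> that it preserves. All inner sums over permutations coincide, so their common
    value is zero in characteristic 0.\<close>
  have "0 = (\<Sum>\<tau> | \<tau> permutes S. \<Sum>f' | f' \<in> colorings S M \<and> f' \<circ> \<tau> = f'. w \<tau>)"
    using zero[of M] by (simp add: mult.commute)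
  also have "\<dots> = (\<Sum>f'\<in>colorings S M. \<Sum>\<tau> | \<tau> permutes S \<and> f' \<circ> \<tau> = f'. w \<tau>)"
    using sum.swap_restrict[OF finP finite_colorings[OF S, of M], of "\<lambda>\<tau> f'. w \<tau>" "\<lambda>\<tau> f'. f' \<circ> \<tau> = f'"]
    by simp
  also have "\<dots> = (\<Sum>f'\<in>colorings S M. \<Sum>\<tau>\<in>A. w \<tau>)"
    unfolding A_def by (intro sum.cong refl sum_stabilizer_coloring_eq[OF S w _ f_mem])
  finally have "(\<Sum>\<tau>\<in>A. w \<tau>) = 0"
    using f_mem finite_colorings[OF S, of M] by auto
  \<comment> \<open>Preserving \<open>f\<close> forces each cycle of \<open>\<tau>\<close> into a
    cycle of \<open>\<sigma>\<close>. Either the cycles agree and \<open>\<tau>\<close> is conjugate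
    to \<open>\<sigma>\<close>, or \<open>\<tau>\<close> has more cycles and the induction
    hypothesis applies.\<close>
  moreover have "w \<tau> = (if \<forall>x. Orbits.orbit \<tau> x = ?o x then w \<sigma> else 0)" if "\<tau> \<in> A" for \<tau>
  proof -
    have \<tau>: "\<tau> permutes S" "f \<circ> \<tau> = f" using that by (auto simp: A_def)
    have sub: "Orbits.orbit \<tau> x \<subseteq> ?o x" for x
    proof (cases "x \<in> S")
      case True
      show ?thesis
      proof
        fix y assume "y \<in> Orbits.orbit \<tau> x"
        then have "f y = f x"
          by induction (use \<tau>(2) in \<open>auto simp: fun_eq_iff\<close>)
        moreover have "y \<in> S"
          using \<open>y \<in> Orbits.orbit \<tau> x\<close> permutes_orbit_subset[OF \<tau>(1) True] by blast
        ultimately show "y \<in> ?o x" using f_inj True self by metis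
      qed
    next
      case False
      then have "\<tau> x = x" using \<tau>(1) by (simp add: permutes_not_in)
      then have "Orbits.orbit \<tau> x = {x}" by (simp add: orbit_eq_singleton_iff)
      then show ?thesis using self by simp
    qed
    show ?thesis
    proof (cases "\<forall>x. Orbits.orbit \<tau> x = ?o x")
      case True
      then obtain g where "g permutes S" "g \<circ> \<tau> = \<sigma> \<circ> g"
        using conjugate_if_same_orbits[OF S \<tau>(1) \<sigma>] by blast
      then show ?thesis using class_functionD[OF w \<tau>(1) \<sigma>] True by simp
    next
      case False
      then have "card (?o ` S) < card (Orbits.orbit \<tau> ` S)"
        using card_orbits_less_if_refines[OF S \<sigma> \<tau>(1) sub] by blast
      moreover have "card (Orbits.orbit \<tau> ` S) \<le> card S"
        using S by (rule card_image_le)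
      ultimately have "w \<tau> = 0" using less.hyps[OF _ \<tau>(1)] by simp
      then show ?thesis by (simp only: if_not_P[OF False])
    qed
  qed
  ultimately have "of_nat (card {\<tau> \<in> A. \<forall>x. Orbits.orbit \<tau> x = ?o x}) * w \<sigma> = 0"
    using finA by (simp add: sum.If_cases Int_def cong: sum.cong)
  \<comment> \<open>\<open>\<sigma>\<close> itself is counted, so the integer factor is nonzero and
    can be cancelled.\<close>
  moreover have "card {\<tau> \<in> A. \<forall>x. Orbits.orbit \<tau> x = ?o x} \<noteq> 0"
    using \<open>\<sigma> \<in> A\<close> finA by auto
  ultimately show "w \<sigma> = 0" by simp
qed

section \<open>Monomial actions and their characters\<close>

lemma mat_trace_mult_comm:
  assumes "A \<in> carrier_mat n n" "B \<in> carrier_mat n n"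
  shows "mat_trace (A * B) = (mat_trace (B * A) :: 'a :: comm_semiring_0)"
proof -
  have tr: "mat_trace (X * Y) = (\<Sum>i<n. \<Sum>j<n. X $$ (i, j) * Y $$ (j, i))"
    if "X \<in> carrier_mat n n" "Y \<in> carrier_mat n n" for X Y :: "'a mat"
    using that by (simp add: mat_trace_def scalar_prod_def atLeast0LessThan)
  have "mat_trace (A * B) = (\<Sum>j<n. \<Sum>i<n. A $$ (i, j) * B $$ (j, i))"
    unfolding tr[OF assms] by (rule sum.swap)
  also have "\<dots> = mat_trace (B * A)"
    unfolding tr[OF assms(2,1)] by (simp add: mult.commute)
  finally show ?thesis .
qed

lemma character_class_function:
  assumes "u \<in> characters d"
  shows "class_function {1..d} u"
  unfolding class_function_def
proof (intro allI impI)
  fix \<sigma> \<tau> g assume perms: "\<sigma> permutes {1..d}" "\<tau> permutes {1..d}" "g permutes {1..d}"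
    and conj: "g \<circ> \<sigma> = \<tau> \<circ> g"
  obtain \<rho> n where u: "u = (\<lambda>\<sigma>\<in>carrier (sym_group d). mat_trace (\<rho> \<sigma>))"
    and \<rho>: "\<rho> \<in> hom (sym_group d) (units_of (ring_mat TYPE('a) n ()))"
    using assms by (auto simp: characters_def)
  have car: "\<rho> \<pi> \<in> carrier_mat n n" if "\<pi> permutes {1..d}" for \<pi>
    using hom_in_carrier[OF \<rho>, of \<pi>] that
    by (auto simp: sym_group_carrier units_of_carrier Units_def ring_mat_simps)
  have mult: "\<rho> (\<pi> \<circ> \<pi>') = \<rho> \<pi> * \<rho> \<pi>'" if "\<pi> permutes {1..d}" "\<pi>' permutes {1..d}" for \<pi> \<pi>'
    using hom_mult[OF \<rho>, of \<pi> \<pi>'] that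
    by (simp add: sym_group_carrier sym_group_mult units_of_mult ring_mat_simps)
  note g' = permutes_inv[OF perms(3)]
  have "\<tau> = (\<tau> \<circ> g) \<circ> inv' g"
    using permutes_inv_o[OF perms(3)] by (simp add: comp_assoc)
  also have "\<dots> = (g \<circ> \<sigma>) \<circ> inv' g"
    using conj by simp
  finally have "mat_trace (\<rho> \<tau>) = mat_trace (\<rho> (g \<circ> \<sigma>) * \<rho> (inv' g))"
    using mult[OF permutes_compose[OF perms(1,3)] g'] by simp
  also have "\<dots> = mat_trace (\<rho> (inv' g) * \<rho> (g \<circ> \<sigma>))"
    using car[OF permutes_compose[OF perms(1,3)]] car[OF g'] by (rule mat_trace_mult_comm)
  also have "\<rho> (inv' g) * \<rho> (g \<circ> \<sigma>) = \<rho> (inv' g \<circ> (g \<circ> \<sigma>))"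
    using mult[OF g' permutes_compose[OF perms(1,3)]] by simp
  also have "inv' g \<circ> (g \<circ> \<sigma>) = \<sigma>"
    using permutes_inv_o[OF perms(3)] by (simp flip: comp_assoc)
  finally show "u \<sigma> = u \<tau>"
    using perms by (simp add: u sym_group_carrier)
qed

lemma virtual_character_class_function:
  assumes "u \<in> virtual_characters d"
  shows "class_function {1..d} u" "u \<in> extensional (carrier (sym_group d))"
proof -
  obtain v w where u: "u = (\<lambda>\<sigma>\<in>carrier (sym_group d). v \<sigma> - w \<sigma>)"
    and vw: "v \<in> characters d" "w \<in> characters d"
    using assms unfolding virtual_characters_def by blast
  show "u \<in> extensional (carrier (sym_group d))"
    by (simp add: u)
  show "class_function {1..d} u"
    unfolding class_function_def
  proof (intro allI impI)
    fix \<sigma> \<tau> g assume a: "\<sigma> permutes {1..d}" "\<tau> permutes {1..d}" "g permutes {1..d}" "g \<circ> \<sigma> = \<tau> \<circ> g"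
    show "u \<sigma> = u \<tau>"
      using class_functionD[OF character_class_function[OF vw(1)] a]
        class_functionD[OF character_class_function[OF vw(2)] a] a
      by (simp add: u sym_group_carrier)
  qed
qed

lemma mcoeff_char_map:
  "mcoeff (char_map d u) M =
    1 / fact d * (\<Sum>\<sigma>\<in>carrier (sym_group d). u \<sigma> * mcoeff (cycle_monomial d \<sigma>) M)"
  by (simp add: char_map_def mcoeff_mconst_mult mcoeff_sum)

text \<open>Comparing coefficients shows that the difference of the two class functions is
  orthogonal to every colouring count, so it vanishes on S_d; outside S_d the two functions agree by
  extensionality. This makes \<open>the_inv_into\<close> a genuine inverse in
  \<open>internal_prod\<close>.\<close>

lemma char_map_inj_on: "inj_on (char_map d) (virtual_characters d)"
proof (rule inj_onI)
  fix u v :: "(nat \<Rightarrow> nat) \<Rightarrow> 'a"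
  assume u: "u \<in> virtual_characters d" and v: "v \<in> virtual_characters d"
    and eq: "char_map d u = char_map d v"
  note cu = virtual_character_class_function[OF u] and cv = virtual_character_class_function[OF v]
  let ?w = "\<lambda>\<sigma>. u \<sigma> - v \<sigma>"
  have "class_function {1..d} ?w"
    unfolding class_function_def
    using class_functionD[OF cu(1)] class_functionD[OF cv(1)] by metis
  moreover have "(\<Sum>\<sigma> | \<sigma> permutes {1..d}.
      ?w \<sigma> * of_nat (card {f \<in> colorings {1..d} M. f \<circ> \<sigma> = f})) = 0" for M
  proof -
    have "0 = (\<Sum>\<sigma>\<in>carrier (sym_group d). ?w \<sigma> * mcoeff (cycle_monomial d \<sigma>) M)"
      using arg_cong[OF eq, of "\<lambda>f. mcoeff f M"]
      by (simp add: mcoeff_char_map left_diff_distrib sum_subtractf)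
    also have "(\<Sum>\<sigma>\<in>carrier (sym_group d). ?w \<sigma> * mcoeff (cycle_monomial d \<sigma>) M) =
        (\<Sum>\<sigma> | \<sigma> permutes {1..d}. ?w \<sigma> * of_nat (card {f \<in> colorings {1..d} M. f \<circ> \<sigma> = f}))"
      by (rule sum.cong) (auto simp: sym_group_carrier mcoeff_cycle_monomial)
    finally show ?thesis by (rule sym)
  qed
  ultimately have "?w \<sigma> = 0" if "\<sigma> permutes {1..d}" for \<sigma>
    using class_function_eq_zero[of "{1..d}" ?w] that by blast
  then show "u = v"
    using cu(2) cv(2) by (intro extensionalityI) (auto simp: sym_group_carrier)
qed

section \<open>Actions with cocycles and the weighted orbit count\<close>

lemma (in group) conj_cancel:
  assumes "x \<in> carrier G" "g \<in> carrier G"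
  shows "x \<otimes> (inv x \<otimes> g \<otimes> x) \<otimes> inv x = g" "inv x \<otimes> (x \<otimes> g \<otimes> inv x) \<otimes> x = g"
    "x \<otimes> g \<otimes> inv x \<otimes> x = x \<otimes> g" "x \<otimes> (inv x \<otimes> g \<otimes> x) = g \<otimes> x"
  using assms by (simp_all add: m_assoc) (simp_all flip: m_assoc)

text \<open>Bijectivity is automatic, with \<open>\<phi> (inv g)\<close> as the inverse of
  \<open>\<phi> g\<close>. The extensional function space is required because
  \<open>BijGroup E\<close> consists of extensional maps.\<close>

lemma (in group) group_actionI:
  assumes closed: "\<And>g. g \<in> carrier G \<Longrightarrow> \<phi> g \<in> E \<rightarrow>\<^sub>E E"
    and one: "\<And>x. x \<in> E \<Longrightarrow> \<phi> \<one> x = x"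
    and mult: "\<And>g h x. g \<in> carrier G \<Longrightarrow> h \<in> carrier G \<Longrightarrow> x \<in> E \<Longrightarrow> \<phi> (g \<otimes> h) x = \<phi> g (\<phi> h x)"
  shows "group_action G E \<phi>"
proof -
  have inv: "\<phi> (inv g) (\<phi> g x) = x" "\<phi> g (\<phi> (inv g) x) = x" if "g \<in> carrier G" "x \<in> E" for g x
    using that mult[of "inv g" g x] mult[of g "inv g" x] one by simp_all
  have Bij: "\<phi> g \<in> Bij E" if "g \<in> carrier G" for g
  proof -
    have "bij_betw (\<phi> g) E E"
      using closed[OF that] closed[OF inv_closed[OF that]] inv[OF that]
      by (intro bij_betw_byWitness[where f' = "\<phi> (inv g)"]) (auto simp: PiE_iff)
    then show ?thesis using closed[OF that] by (auto simp: Bij_def PiE_iff)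
  qed
  have "\<phi> (g \<otimes> h) = compose E (\<phi> g) (\<phi> h)" if "g \<in> carrier G" "h \<in> carrier G" for g h
  proof
    fix x show "\<phi> (g \<otimes> h) x = compose E (\<phi> g) (\<phi> h) x"
      using mult[OF that, of x] closed[OF m_closed[OF that]]
      by (cases "x \<in> E") (auto simp: compose_def PiE_iff extensional_def)
  qed
  then have "\<phi> \<in> hom G (BijGroup E)"
    using Bij by (intro homI) (auto simp: BijGroup_def)
  then show ?thesis
    by (simp add: group_action_def group_hom_def group_hom_axioms_def group_BijGroup group_axioms)
qed

text \<open>
  The monomial representation \<open>g e = b e g \<cdot> \<phi> g e\<close> on the vector space with basis \<open>E\<close>; its
  character is \<open>fixed_point_sum\<close>.
\<close>

locale monomial_action = group_action G E \<phi> for G (structure) and E and \<phi> +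
  fixes b :: "'c \<Rightarrow> 'a \<Rightarrow> 'k :: field_char_0"
  assumes cocycle_one: "e \<in> E \<Longrightarrow> b e \<one> = 1"
    and cocycle_mult: "e \<in> E \<Longrightarrow> g \<in> carrier G \<Longrightarrow> h \<in> carrier G \<Longrightarrow> b e (g \<otimes> h) = b (\<phi> h e) g * b e h"

definition fixed_point_sum :: "'c set \<Rightarrow> ('a \<Rightarrow> 'c \<Rightarrow> 'c) \<Rightarrow> ('c \<Rightarrow> 'a \<Rightarrow> 'k) \<Rightarrow> 'a \<Rightarrow> 'k :: comm_monoid_add" where
  "fixed_point_sum E \<phi> b g = (\<Sum>e\<in>invariants E \<phi> g. b e g)"

context monomial_action
begin

sublocale group G
  using group_hom by (rule group_hom.axioms)

lemma action_closed: "e \<in> E \<Longrightarrow> g \<in> carrier G \<Longrightarrow> \<phi> g e \<in> E"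
  using element_image by blast

lemma action_one: "e \<in> E \<Longrightarrow> \<phi> \<one> e = e"
  using id_eq_one by (metis restrict_apply')

text \<open>The cocycle identity for \<open>inv g \<otimes> g\<close> displays \<open>b e g\<close>
  as a factor of 1.\<close>

lemma cocycle_nonzero:
  assumes "e \<in> E" "g \<in> carrier G"
  shows "b e g \<noteq> 0"
  using cocycle_mult[OF assms(1) inv_closed[OF assms(2)] assms(2)] cocycle_one[OF assms(1)] assms(2)
  by auto

text \<open>On a stabilizer the cocycle is a one-dimensional character. Evaluating
  \<open>b e (x \<otimes> g)\<close> through both factorizations of the element, and cancelling
  \<open>b e x\<close>, shows that moving the base point by \<open>x\<close> conjugates this
  character.\<close>

lemma cocycle_conj:
  assumes e: "e \<in> E" and x: "x \<in> carrier G" and g: "g \<in> stabilizer G \<phi> e"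
  shows "x \<otimes> g \<otimes> inv x \<in> stabilizer G \<phi> (\<phi> x e)" "b (\<phi> x e) (x \<otimes> g \<otimes> inv x) = b e g"
proof -
  have gc: "g \<in> carrier G" and ge: "\<phi> g e = e" using g by (auto simp: stabilizer_def)
  have xg: "x \<otimes> g \<otimes> inv x \<in> carrier G" using x gc by simp
  have eq: "x \<otimes> g \<otimes> inv x \<otimes> x = x \<otimes> g" using conj_cancel(3)[OF x gc] .
  have "\<phi> (x \<otimes> g \<otimes> inv x) (\<phi> x e) = \<phi> (x \<otimes> g) e"
    using composition_rule[OF e xg x] eq by simp
  also have "\<dots> = \<phi> x e" using composition_rule[OF e x gc] ge by simp
  finally show "x \<otimes> g \<otimes> inv x \<in> stabilizer G \<phi> (\<phi> x e)"
    using xg by (simp add: stabilizer_def)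
  have "b (\<phi> x e) (x \<otimes> g \<otimes> inv x) * b e x = b e (x \<otimes> g)"
    using cocycle_mult[OF e xg x] eq by simp
  also have "\<dots> = b e g * b e x" using cocycle_mult[OF e x gc] ge by simp
  finally show "b (\<phi> x e) (x \<otimes> g \<otimes> inv x) = b e g"
    using cocycle_nonzero[OF e x] by simp
qed

lemma stabilizer_sum_orbit:
  assumes e: "e \<in> E" and x: "x \<in> carrier G"
    and c: "\<And>g h. g \<in> carrier G \<Longrightarrow> h \<in> carrier G \<Longrightarrow> c (h \<otimes> g \<otimes> inv h) = c g"
  shows "(\<Sum>g\<in>stabilizer G \<phi> (\<phi> x e). b (\<phi> x e) g * c g) = (\<Sum>g\<in>stabilizer G \<phi> e. b e g * c g)"
proof (rule sum.reindex_bij_witness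
    [where i = "\<lambda>g. x \<otimes> g \<otimes> inv x" and j = "\<lambda>g. inv x \<otimes> g \<otimes> x"])
  note stc = stabilizer_subset[THEN subsetD]
  have xe: "\<phi> x e \<in> E" "\<phi> (inv x) (\<phi> x e) = e"
    using action_closed[OF e x] orbit_sym_aux[OF x e refl] by auto
  {
    fix g assume g: "g \<in> stabilizer G \<phi> (\<phi> x e)"
    show "x \<otimes> (inv x \<otimes> g \<otimes> x) \<otimes> inv x = g"
      using conj_cancel(1)[OF x stc[OF g]] .
    show st: "inv x \<otimes> g \<otimes> x \<in> stabilizer G \<phi> e"
      using cocycle_conj(1)[OF xe(1) inv_closed[OF x] g] x xe(2) by simp
    show "b e (inv x \<otimes> g \<otimes> x) * c (inv x \<otimes> g \<otimes> x) = b (\<phi> x e) g * c g"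
      using cocycle_conj(2)[OF e x st] c[OF stc[OF st] x] conj_cancel(1)[OF x stc[OF g]] by simp
  next
    fix g assume g: "g \<in> stabilizer G \<phi> e"
    show "inv x \<otimes> (x \<otimes> g \<otimes> inv x) \<otimes> x = g"
      using conj_cancel(2)[OF x stc[OF g]] .
    show "x \<otimes> g \<otimes> inv x \<in> stabilizer G \<phi> (\<phi> x e)"
      using cocycle_conj(1)[OF e x g] .
  }
qed

text \<open>A weighted Burnside lemma, which for \<open>b\<close> and \<open>c\<close> constantly 1
  counts the orbits. The pairs of a group element and a point fixed by it are summed point by point;
  the inner sum is constant on orbits, and the orbit-stabilizer theorem replaces the orbit
  length.\<close>

lemma average_fixed_point_sum:
  assumes finE: "finite E" and finG: "finite (carrier G)" and T: "orbit_representatives G E \<phi> T"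
    and c: "\<And>g h. g \<in> carrier G \<Longrightarrow> h \<in> carrier G \<Longrightarrow> c (h \<otimes> g \<otimes> inv h) = c g"
  shows "1 / of_nat (Coset.order G) * (\<Sum>g\<in>carrier G. fixed_point_sum E \<phi> b g * c g) =
    (\<Sum>t\<in>T. 1 / of_nat (card (stabilizer G \<phi> t)) * (\<Sum>g\<in>stabilizer G \<phi> t. b t g * c g))"
proof -
  define h where "h e = (\<Sum>g\<in>stabilizer G \<phi> e. b e g * c g)" for e
  have TE: "T \<subseteq> E" and unique: "\<And>Q. Q \<in> orbits G E \<phi> \<Longrightarrow> \<exists>!t. t \<in> T \<and> t \<in> Q"
    using T by (auto simp: orbit_representatives_def)
  have "(\<Sum>g\<in>carrier G. fixed_point_sum E \<phi> b g * c g) =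
      (\<Sum>g\<in>carrier G. \<Sum>e | e \<in> E \<and> \<phi> g e = e. b e g * c g)"
    by (simp add: fixed_point_sum_def invariants_def sum_distrib_right)
  also have "\<dots> = (\<Sum>e\<in>E. h e)"
    unfolding h_def stabilizer_def by (rule sum.swap_restrict[OF finG finE])
  also have "\<dots> = (\<Sum>Q\<in>orbits G E \<phi>. \<Sum>e\<in>Q. h e)"
  proof -
    have "finite Q" if "Q \<in> orbits G E \<phi>" for Q
      using that orbits_coverture finite_subset[OF _ finE] by blast
    then have "(\<Sum>e\<in>\<Union> (orbits G E \<phi>). h e) = (\<Sum>Q\<in>orbits G E \<phi>. \<Sum>e\<in>Q. h e)"
      using disjoint_union by (subst sum.Union_disjoint) auto
    then show ?thesis by (simp only: orbits_coverture)
  qed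
  also have "\<dots> = (\<Sum>t\<in>T. \<Sum>e\<in>Group_Action.orbit G \<phi> t. h e)"
  proof (rule sum.reindex_bij_betw[symmetric])
    have orb: "Group_Action.orbit G \<phi> t \<in> orbits G E \<phi>" if "t \<in> T" for t
      using that TE by (auto simp: orbits_def)
    have self: "t \<in> Group_Action.orbit G \<phi> t" if "t \<in> T" for t
      using that TE orbit_refl by blast
    show "bij_betw (\<lambda>t. Group_Action.orbit G \<phi> t) T (orbits G E \<phi>)"
      unfolding bij_betw_def
    proof
      show "inj_on (\<lambda>t. Group_Action.orbit G \<phi> t) T"
        by (rule inj_onI) (use unique orb self in metis)
      show "(\<lambda>t. Group_Action.orbit G \<phi> t) ` T = orbits G E \<phi>"
      proof
        show "orbits G E \<phi> \<subseteq> (\<lambda>t. Group_Action.orbit G \<phi> t) ` T"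
        proof
          fix Q assume Q: "Q \<in> orbits G E \<phi>"
          then obtain t where t: "t \<in> T" "t \<in> Q" using unique by blast
          then have "Q = Group_Action.orbit G \<phi> t"
            using disjoint_union[OF Q orb[OF t(1)]] self[OF t(1)] by blast
          then show "Q \<in> (\<lambda>t. Group_Action.orbit G \<phi> t) ` T" using t(1) by blast
        qed
      qed (use orb in blast)
    qed
  qed
  also have "\<dots> = (\<Sum>t\<in>T. of_nat (Coset.order G) * (1 / of_nat (card (stabilizer G \<phi> t)) * h t))"
  proof (rule sum.cong[OF refl])
    fix t assume "t \<in> T"
    then have t: "t \<in> E" using TE by blast
    have "h e = h t" if "e \<in> Group_Action.orbit G \<phi> t" for e
      using that stabilizer_sum_orbit[OF t _ c] by (auto simp: Group_Action.orbit_def h_def)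
    then have "(\<Sum>e\<in>Group_Action.orbit G \<phi> t. h e) = of_nat (card (Group_Action.orbit G \<phi> t)) * h t"
      by simp
    moreover have "card (stabilizer G \<phi> t) > 0"
      using stabilizer_one_closed[OF t] finite_subset[OF stabilizer_subset finG]
      by (auto simp: card_gt_0_iff)
    ultimately show "(\<Sum>e\<in>Group_Action.orbit G \<phi> t. h e) =
        of_nat (Coset.order G) * (1 / of_nat (card (stabilizer G \<phi> t)) * h t)"
      by (simp flip: orbit_stabilizer_theorem[OF t])
  qed
  also have "\<dots> = of_nat (Coset.order G) * (\<Sum>t\<in>T. 1 / of_nat (card (stabilizer G \<phi> t)) * h t)"
    by (simp only: sum_distrib_left)
  finally show ?thesis
    using finG by (simp add: h_def order_gt_0_iff_finite[symmetric])
qed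

lemma fixed_point_sum_trace:
  assumes finE: "finite E"
  obtains \<rho> n where "\<rho> \<in> hom G (units_of (ring_mat TYPE('k) n ()))"
    and "\<And>g. g \<in> carrier G \<Longrightarrow> mat_trace (\<rho> g) = fixed_point_sum E \<phi> b g"
proof -
  define n where "n = card E"
  obtain en where en: "bij_betw en {0..<n} E"
    using ex_bij_betw_nat_finite[OF finE] unfolding n_def by blast
  have en_mem: "en i \<in> E" if "i < n" for i
    using that bij_betwE[OF en] by simp
  have en_inj: "en i = en j \<longleftrightarrow> i = j" if "i < n" "j < n" for i j
    using inj_on_eq_iff[OF bij_betw_imp_inj_on[OF en], of i j] that by simp
  have en_ex: "\<exists>i<n. en i = e" if "e \<in> E" for e
    using bij_betw_imp_surj_on[OF en] that by force
  \<comment> \<open>Column \<open>j\<close> has a single nonzero entry, in the row of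
    \<open>\<phi> g (en j)\<close>; it lies on the diagonal exactly when \<open>en j\<close> is
    fixed.\<close>
  define \<rho> where "\<rho> g = mat n n (\<lambda>(i, j). if \<phi> g (en j) = en i then b (en j) g else 0)" for g
  have car: "\<rho> g \<in> carrier_mat n n" for g by (simp add: \<rho>_def)
  have mult: "\<rho> (g \<otimes> h) = \<rho> g * \<rho> h" if g: "g \<in> carrier G" and h: "h \<in> carrier G" for g h
  proof (rule eq_matI)
    fix i j assume ij: "i < dim_row (\<rho> g * \<rho> h)" "j < dim_col (\<rho> g * \<rho> h)"
    then have ij: "i < n" "j < n" by (simp_all add: \<rho>_def)
    \<comment> \<open>The only index that survives in the sum defining the matrix product.\<close>
    obtain l where l: "l < n" "en l = \<phi> h (en j)"
      using en_ex[OF action_closed[OF en_mem[OF ij(2)] h]] by blast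
    have "(\<rho> g * \<rho> h) $$ (i, j) = (\<Sum>m\<in>{0..<n}. \<rho> g $$ (i, m) * \<rho> h $$ (m, j))"
      using ij car[of g] car[of h] by (simp add: scalar_prod_def)
    also have "\<dots> = (\<Sum>m\<in>{0..<n}. if m = l then \<rho> g $$ (i, l) * b (en j) h else 0)"
      using ij l by (intro sum.cong refl) (auto simp: \<rho>_def en_inj simp flip: l(2))
    also have "\<dots> = \<rho> g $$ (i, l) * b (en j) h" using l by simp
    also have "\<dots> = \<rho> (g \<otimes> h) $$ (i, j)"
      using ij l composition_rule[OF en_mem[OF ij(2)] g h] cocycle_mult[OF en_mem[OF ij(2)] g h]
      by (simp add: \<rho>_def)
    finally show "\<rho> (g \<otimes> h) $$ (i, j) = (\<rho> g * \<rho> h) $$ (i, j)" by simp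
  qed (simp_all add: \<rho>_def)
  have one: "\<rho> \<one> = 1\<^sub>m n"
    by (rule eq_matI) (auto simp: \<rho>_def action_one en_mem en_inj cocycle_one)
  have "\<rho> \<in> hom G (units_of (ring_mat TYPE('k) n ()))"
  proof (rule homI)
    fix g assume g: "g \<in> carrier G"
    show "\<rho> g \<in> carrier (units_of (ring_mat TYPE('k) n ()))"
      using car mult[OF g inv_closed[OF g]] mult[OF inv_closed[OF g] g] g one
      by (auto simp: units_of_carrier Units_def ring_mat_simps intro!: bexI[of _ "\<rho> (inv g)"])
  qed (simp add: mult units_of_mult ring_mat_simps)
  moreover have "mat_trace (\<rho> g) = fixed_point_sum E \<phi> b g" for g
  proof -
    have "mat_trace (\<rho> g) = (\<Sum>i\<in>{0..<n}. if \<phi> g (en i) = en i then b (en i) g else 0)"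
      by (simp add: mat_trace_def \<rho>_def atLeast0LessThan)
    also have "\<dots> = (\<Sum>e\<in>E. if \<phi> g e = e then b e g else 0)"
      using sum.reindex_bij_betw[OF en] .
    also have "\<dots> = fixed_point_sum E \<phi> b g"
      using finE by (simp add: fixed_point_sum_def invariants_def sum.inter_filter)
    finally show ?thesis .
  qed
  ultimately show thesis using that by blast
qed

end

text \<open>The zero-dimensional representation. Its character is the subtrahend that turns a
  genuine character into a virtual one.\<close>

lemma zero_character: "(\<lambda>\<sigma>\<in>carrier (sym_group d). 0) \<in> characters d"
proof -
  have "(\<lambda>_. 1\<^sub>m 0) \<in> hom (sym_group d) (units_of (ring_mat TYPE('a) 0 ()))"
    by (auto intro!: homI simp: units_of_carrier units_of_mult Units_def ring_mat_simps)
  moreover have "mat_trace (1\<^sub>m 0 :: 'a mat) = 0" by (simp add: mat_trace_def)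
  ultimately show ?thesis unfolding characters_def by fastforce
qed

lemma fixed_point_sum_virtual_character:
  fixes b :: "'c \<Rightarrow> (nat \<Rightarrow> nat) \<Rightarrow> 'k :: field_char_0"
  assumes "monomial_action (sym_group d) E \<phi> b" "finite E"
  shows "(\<lambda>\<sigma>\<in>carrier (sym_group d). fixed_point_sum E \<phi> b \<sigma>) \<in> virtual_characters d"
proof -
  interpret monomial_action "sym_group d" E \<phi> b by fact
  let ?u = "\<lambda>\<sigma>\<in>carrier (sym_group d). fixed_point_sum E \<phi> b \<sigma>"
  obtain \<rho> n where \<rho>: "\<rho> \<in> hom (sym_group d) (units_of (ring_mat TYPE('k) n ()))"
    and tr: "\<And>g. g \<in> carrier (sym_group d) \<Longrightarrow> mat_trace (\<rho> g) = fixed_point_sum E \<phi> b g"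
    using fixed_point_sum_trace[OF assms(2)] by blast
  have "?u = (\<lambda>\<sigma>\<in>carrier (sym_group d). mat_trace (\<rho> \<sigma>))"
    by (rule restrict_ext) (simp add: tr)
  then have "?u \<in> characters d"
    using \<rho> unfolding characters_def by blast
  moreover have "?u = (\<lambda>\<sigma>\<in>carrier (sym_group d). ?u \<sigma> - (\<lambda>\<sigma>\<in>carrier (sym_group d). 0) \<sigma>)"
    by (rule restrict_ext) simp
  ultimately show ?thesis
    using zero_character unfolding virtual_characters_def by blast
qed

section \<open>Coset actions\<close>

lemma restrict_eq_iff:
  "\<omega> \<in> extensional A \<Longrightarrow> restrict f A = \<omega> \<longleftrightarrow> (\<forall>m\<in>A. f m = \<omega> m)"
  by (auto simp: fun_eq_iff restrict_def extensional_def)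

context group
begin

lemma coset_action_ex1:
  assumes H: "subgroup H G" and I: "left_transversal G H I" and \<zeta>: "\<zeta> \<in> carrier G" and i: "i \<in> carrier G"
  shows "\<exists>!j. j \<in> I \<and> inv j \<otimes> \<zeta> \<otimes> i \<in> H"
proof -
  interpret H: subgroup H G by fact
  have IG: "I \<subseteq> carrier G" using I by (simp add: left_transversal_def)
  have "(\<zeta> \<otimes> i) <# H \<in> lcosets H"
    using \<zeta> i by (auto simp: LCOSETS_def)
  then have ex1: "\<exists>!j. j \<in> I \<and> j \<in> (\<zeta> \<otimes> i) <# H"
    using I by (simp add: left_transversal_def)
  have "j \<in> (\<zeta> \<otimes> i) <# H \<longleftrightarrow> inv j \<otimes> \<zeta> \<otimes> i \<in> H" if "j \<in> I" for j
  proof -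
    have j: "j \<in> carrier G" using that IG by blast
    \<comment> \<open>Coset membership is tested on
      \<open>inv (\<zeta> \<otimes> i) \<otimes> j\<close>, the inverse of the element in question,
      and \<open>H\<close> is closed under inverses.\<close>
    have inv_eq: "inv (inv j \<otimes> \<zeta> \<otimes> i) = inv (\<zeta> \<otimes> i) \<otimes> j"
      using j \<zeta> i by (simp add: inv_mult_group m_assoc)
    have "inv (\<zeta> \<otimes> i) \<otimes> j \<in> H \<longleftrightarrow> inv j \<otimes> \<zeta> \<otimes> i \<in> H"
      using H.m_inv_closed inv_eq j \<zeta> i by (metis inv_closed inv_inv m_closed)
    then show ?thesis
      using H.lcos_module_imp[OF is_group, of "\<zeta> \<otimes> i" j] H.lcos_module_rev[OF is_group, of "\<zeta> \<otimes> i" j]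
        j \<zeta> i by auto
  qed
  then show ?thesis using ex1 by metis
qed

lemma coset_action:
  assumes "subgroup H G" "left_transversal G H I" "\<zeta> \<in> carrier G" "i \<in> carrier G"
  shows "coset_action G H I \<zeta> i \<in> I" "inv (coset_action G H I \<zeta> i) \<otimes> \<zeta> \<otimes> i \<in> H"
  using theI'[OF coset_action_ex1[OF assms]] by (simp_all add: coset_action_def)

lemma coset_action_eqI:
  assumes "subgroup H G" "left_transversal G H I" "\<zeta> \<in> carrier G" "i \<in> carrier G"
    and "j \<in> I" "inv j \<otimes> \<zeta> \<otimes> i \<in> H"
  shows "coset_action G H I \<zeta> i = j"
  unfolding coset_action_def
  using coset_action_ex1[OF assms(1-4)] assms(5,6) by (intro the1_equality) auto

lemma inv_mult_cancel:
  "x \<in> carrier G \<Longrightarrow> y \<in> carrier G \<Longrightarrow> inv x \<otimes> (x \<otimes> inv y) \<otimes> y = \<one>"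
  by (simp add: m_assoc)

text \<open>This is the representation induced from \<open>\<chi>\<close>, in the basis given by the
  transversal: \<open>\<zeta> \<otimes> i\<close> is the new representative times an element of
  \<open>H\<close>, and that element acts by its value under \<open>\<chi>\<close>.\<close>

lemma monomial_action_cosets:
  assumes H: "subgroup H G" and I: "left_transversal G H I"
    and \<chi>: "\<chi> \<in> hom (G\<lparr>carrier := H\<rparr>) (units_of (class_ring :: 'k :: field_char_0 ring))"
  shows "monomial_action G I (\<lambda>\<zeta>. restrict (coset_action G H I \<zeta>) I)
    (\<lambda>i \<zeta>. \<chi> (inv (coset_action G H I \<zeta> i) \<otimes> \<zeta> \<otimes> i))"
proof -
  interpret H: subgroup H G by fact
  let ?s = "coset_action G H I"
  have IG: "i \<in> carrier G" if "i \<in> I" for i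
    using that I by (auto simp: left_transversal_def)
  note s = coset_action[OF H I] and s_eqI = coset_action_eqI[OF H I]
  have \<chi>_mult: "\<chi> (x \<otimes> y) = \<chi> x * \<chi> y" if "x \<in> H" "y \<in> H" for x y
    using hom_mult[OF \<chi>, of x y] that by (simp add: units_of_mult)
  have \<chi>_one: "\<chi> \<one> = 1"
  proof -
    have "\<chi> \<one> \<in> Units (class_ring :: 'k ring)"
      using hom_in_carrier[OF \<chi>, of \<one>] by (simp add: units_of_carrier)
    then have "\<chi> \<one> \<noteq> 0" by (auto simp: Units_def)
    then show ?thesis using \<chi>_mult[of \<one> \<one>] by simp
  qed
  have s_one: "?s \<one> i = i" if "i \<in> I" for i
    using that IG[OF that] by (intro s_eqI) auto
  \<comment> \<open>Inserting \<open>l \<otimes> inv l\<close>, with \<open>l\<close> the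
    representative reached from \<open>i\<close> by \<open>h\<close>, gives two factors in
    \<open>H\<close>. This yields both the action law and the cocycle identity.\<close>
  have split: "inv j \<otimes> (g \<otimes> h) \<otimes> i = (inv j \<otimes> g \<otimes> l) \<otimes> (inv l \<otimes> h \<otimes> i)"
    if "g \<in> carrier G" "h \<in> carrier G" "i \<in> carrier G" "j \<in> carrier G" "l \<in> carrier G" for g h i j l
  proof -
    have "(inv j \<otimes> g \<otimes> l) \<otimes> (inv l \<otimes> h \<otimes> i) = inv j \<otimes> g \<otimes> (l \<otimes> inv l) \<otimes> h \<otimes> i"
      using that by (simp only: m_assoc m_closed inv_closed)
    also have "\<dots> = inv j \<otimes> (g \<otimes> h) \<otimes> i"
      using that by (simp add: m_assoc)
    finally show ?thesis by (rule sym)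
  qed
  have s_mult: "?s (g \<otimes> h) i = ?s g (?s h i)"
    if g: "g \<in> carrier G" and h: "h \<in> carrier G" and i: "i \<in> I" for g h i
  proof (rule s_eqI)
    note l = s[OF h IG[OF i]]
    note j = s[OF g IG[OF l(1)]]
    show "?s g (?s h i) \<in> I" using j(1) .
    show "inv (?s g (?s h i)) \<otimes> (g \<otimes> h) \<otimes> i \<in> H"
      using split[OF g h IG[OF i] IG[OF j(1)] IG[OF l(1)]] j(2) l(2) by simp
  qed (use g h IG[OF i] in auto)
  have "group_action G I (\<lambda>\<zeta>. restrict (?s \<zeta>) I)"
    by (rule group_actionI) (use s IG s_one s_mult in auto)
  then show ?thesis
  proof (rule monomial_action.intro)
    show "monomial_action_axioms G I (\<lambda>\<zeta>. restrict (?s \<zeta>) I) (\<lambda>i \<zeta>. \<chi> (inv (?s \<zeta> i) \<otimes> \<zeta> \<otimes> i))"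
    proof
      show "\<chi> (inv (?s \<one> i) \<otimes> \<one> \<otimes> i) = 1" if "i \<in> I" for i
        using s_one[OF that] IG[OF that] \<chi>_one by simp
    next
      fix i g h assume i: "i \<in> I" and g: "g \<in> carrier G" and h: "h \<in> carrier G"
      note l = s[OF h IG[OF i]]
      note j = s[OF g IG[OF l(1)]]
      show "\<chi> (inv (?s (g \<otimes> h) i) \<otimes> (g \<otimes> h) \<otimes> i) =
          \<chi> (inv (?s g (restrict (?s h) I i)) \<otimes> g \<otimes> restrict (?s h) I i) * \<chi> (inv (?s h i) \<otimes> h \<otimes> i)"
        using i split[OF g h IG[OF i] IG[OF j(1)] IG[OF l(1)]] \<chi>_mult[OF j(2) l(2)]
        by (simp add: s_mult[OF g h i])
    qed
  qed
qed

text \<open>The tensor product of the monomial representations, with tuples of basis elements as its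
  basis.\<close>

lemma monomial_action_PiE:
  assumes fin: "finite A" and act: "\<And>m. m \<in> A \<Longrightarrow> monomial_action G (E m) (\<phi> m) (b m)"
  shows "monomial_action G (PiE A E) (\<lambda>g. \<lambda>\<omega>\<in>PiE A E. \<lambda>m\<in>A. \<phi> m g (\<omega> m)) (\<lambda>\<omega> g. \<Prod>m\<in>A. b m (\<omega> m) g)"
    (is "monomial_action G ?E ?\<phi> ?b")
proof -
  have closed: "\<phi> m g e \<in> E m" if "m \<in> A" "g \<in> carrier G" "e \<in> E m" for m g e
    using monomial_action.action_closed[OF act] that by blast
  have ga: "group_action G (E m) (\<phi> m)" if "m \<in> A" for m
    using act[OF that] by (rule monomial_action.axioms)
  have mem: "\<omega> m \<in> E m" if "\<omega> \<in> ?E" "m \<in> A" for \<omega> m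
    using that by (rule PiE_mem)
  have tup: "(\<lambda>m\<in>A. \<phi> m g (\<omega> m)) \<in> ?E" if "\<omega> \<in> ?E" "g \<in> carrier G" for \<omega> g
    using closed mem that by auto
  have "group_action G ?E ?\<phi>"
  proof (rule group_actionI)
    fix g assume "g \<in> carrier G"
    then show "?\<phi> g \<in> ?E \<rightarrow>\<^sub>E ?E" using tup by auto
  next
    fix \<omega> assume \<omega>: "\<omega> \<in> ?E"
    have "(\<lambda>m\<in>A. \<phi> m \<one> (\<omega> m)) = \<omega>"
    proof (rule extensionalityI[of _ A])
      show "\<omega> \<in> extensional A" using \<omega> by (simp add: PiE_def)
    qed (use monomial_action.action_one[OF act] mem[OF \<omega>] in auto)
    then show "?\<phi> \<one> \<omega> = \<omega>" using \<omega> by simp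
  next
    fix g h \<omega> assume g: "g \<in> carrier G" and h: "h \<in> carrier G" and \<omega>: "\<omega> \<in> ?E"
    have "(\<lambda>m\<in>A. \<phi> m (g \<otimes> h) (\<omega> m)) = (\<lambda>m\<in>A. \<phi> m g ((\<lambda>m\<in>A. \<phi> m h (\<omega> m)) m))"
      by (rule restrict_ext) (simp add: group_action.composition_rule[OF ga] mem[OF \<omega>] g h)
    then show "?\<phi> (g \<otimes> h) \<omega> = ?\<phi> g (?\<phi> h \<omega>)"
      using \<omega> tup[OF \<omega> h] by simp
  qed
  then show ?thesis
  proof (rule monomial_action.intro)
    show "monomial_action_axioms G ?E ?\<phi> ?b"
    proof
      fix \<omega> assume \<omega>: "\<omega> \<in> ?E"
      show "?b \<omega> \<one> = 1"
        by (intro prod.neutral ballI) (simp add: monomial_action.cocycle_one[OF act] mem[OF \<omega>])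
      fix g h assume g: "g \<in> carrier G" and h: "h \<in> carrier G"
      have "?b \<omega> (g \<otimes> h) = (\<Prod>m\<in>A. b m (?\<phi> h \<omega> m) g * b m (\<omega> m) h)"
      proof (rule prod.cong[OF refl])
        fix m assume m: "m \<in> A"
        show "b m (\<omega> m) (g \<otimes> h) = b m (?\<phi> h \<omega> m) g * b m (\<omega> m) h"
          using monomial_action.cocycle_mult[OF act[OF m] mem[OF \<omega> m] g h] \<omega> m by simp
      qed
      then show "?b \<omega> (g \<otimes> h) = ?b (?\<phi> h \<omega>) g * ?b \<omega> h"
        by (simp only: prod.distrib)
    qed
  qed
qed

end

text \<open>The fixed tuples form the product of the coordinatewise fixed sets, so distributivity
  turns the sum of products into a product of sums: characters of tensor products multiply.\<close>

lemma fixed_point_sum_PiE: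
  fixes b :: "'m \<Rightarrow> 'c \<Rightarrow> 'a \<Rightarrow> 'k :: comm_semiring_1"
  assumes A: "finite A" and E: "\<And>m. m \<in> A \<Longrightarrow> finite (E m)"
  shows "fixed_point_sum (PiE A E) (\<lambda>g. \<lambda>\<omega>\<in>PiE A E. \<lambda>m\<in>A. \<phi> m g (\<omega> m)) (\<lambda>\<omega> g. \<Prod>m\<in>A. b m (\<omega> m) g) g =
    (\<Prod>m\<in>A. fixed_point_sum (E m) (\<phi> m) (b m) g)"
proof -
  have "(\<Prod>m\<in>A. fixed_point_sum (E m) (\<phi> m) (b m) g) =
      (\<Sum>\<omega>\<in>PiE A (\<lambda>m. invariants (E m) (\<phi> m) g). \<Prod>m\<in>A. b m (\<omega> m) g)"
    unfolding fixed_point_sum_def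
    by (rule prod_sum_PiE[OF A]) (simp add: invariants_def E)
  moreover have "PiE A (\<lambda>m. invariants (E m) (\<phi> m) g) =
      invariants (PiE A E) (\<lambda>g. \<lambda>\<omega>\<in>PiE A E. \<lambda>m\<in>A. \<phi> m g (\<omega> m)) g"
    by (rule Set.set_eqI) (simp add: invariants_def PiE_iff restrict_eq_iff, blast)
  ultimately show ?thesis by (simp add: fixed_point_sum_def)
qed

section \<open>The characteristic map on monomial characters\<close>

lemma finite_carrier_sym_group: "finite (carrier (sym_group d))"
  by (simp add: sym_group_def finite_permutations)

lemma order_sym_group: "Coset.order (sym_group d) = fact d"
  using card_permutations[of "{1..d}" d] by (simp add: Coset.order_def sym_group_def)

lemma mcoeff_cycle_monomial_conj:
  assumes g: "g \<in> carrier (sym_group d)" and h: "h \<in> carrier (sym_group d)"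
  shows "mcoeff (cycle_monomial d (h \<otimes>\<^bsub>sym_group d\<^esub> g \<otimes>\<^bsub>sym_group d\<^esub> inv\<^bsub>sym_group d\<^esub> h)) M =
    mcoeff (cycle_monomial d g) M"
proof -
  interpret group "sym_group d" by (rule sym_group_is_group)
  define g' where "g' = h \<otimes>\<^bsub>sym_group d\<^esub> g \<otimes>\<^bsub>sym_group d\<^esub> inv\<^bsub>sym_group d\<^esub> h"
  have g': "g' \<in> carrier (sym_group d)"
    unfolding g'_def using g h by (intro m_closed inv_closed)
  have "h \<circ> g = g' \<circ> h"
    using conj_cancel(3)[OF h g] by (simp only: g'_def sym_group_mult)
  then show ?thesis
    using class_functionD[OF card_fixed_colorings_class_function[of "{1..d}" M], of g g' h] g g' h
    unfolding g'_def[symmetric] by (simp only: mcoeff_cycle_monomial sym_group_carrier)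
qed

lemma mcoeff_cyclic_index:
  "mcoeff (cyclic_index d W \<chi>) M =
    1 / of_nat (card W) * (\<Sum>\<sigma>\<in>W. \<chi> \<sigma> * mcoeff (cycle_monomial d \<sigma>) M)"
  by (simp add: cyclic_index_def mcoeff_mconst_mult mcoeff_sum)

text \<open>Each coefficient of the cycle monomial is a class function, so the weighted orbit count
  applies one monomial at a time, with that coefficient as \<open>c\<close>.\<close>

lemma char_map_fixed_point_sum:
  assumes act: "monomial_action (sym_group d) E \<phi> b" and fin: "finite E"
    and T: "orbit_representatives (sym_group d) E \<phi> T"
  shows "char_map d (\<lambda>\<sigma>\<in>carrier (sym_group d). fixed_point_sum E \<phi> b \<sigma>) =
    (\<Sum>t\<in>T. cyclic_index d (stabilizer (sym_group d) \<phi> t) (b t))"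
proof (rule mseries_eqI)
  fix M
  interpret monomial_action "sym_group d" E \<phi> b by fact
  show "mcoeff (char_map d (\<lambda>\<sigma>\<in>carrier (sym_group d). fixed_point_sum E \<phi> b \<sigma>)) M =
    mcoeff (\<Sum>t\<in>T. cyclic_index d (stabilizer (sym_group d) \<phi> t) (b t)) M"
    using average_fixed_point_sum[OF fin finite_carrier_sym_group T,
        of "\<lambda>\<sigma>. mcoeff (cycle_monomial d \<sigma>) M", OF mcoeff_cycle_monomial_conj]
    by (simp add: mcoeff_char_map mcoeff_cyclic_index mcoeff_sum order_sym_group)
qed

lemma internal_prod_char_map:
  assumes "u \<in> virtual_characters d" "v \<in> virtual_characters d"
  shows "internal_prod d (char_map d u) (char_map d v) =
    char_map d (\<lambda>\<sigma>\<in>carrier (sym_group d). u \<sigma> * v \<sigma>)"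
  by (simp add: internal_prod_def the_inv_into_f_f[OF char_map_inj_on] assms)

text \<open>The right-hand side is the characteristic of the induced character. The coset action is
  transitive, so the orbit sum has one term, taken at the representative of the coset
  \<open>W\<close>.\<close>

lemma cyclic_index_eq_char_map:
  assumes W: "subgroup W (sym_group d)" and \<chi>: "\<chi> \<in> one_dim_characters d W"
    and I: "left_transversal (sym_group d) W I"
  shows "cyclic_index d W \<chi> = char_map d (\<lambda>\<sigma>\<in>carrier (sym_group d).
    fixed_point_sum I (\<lambda>\<zeta>. restrict (coset_action (sym_group d) W I \<zeta>) I)
      (\<lambda>i \<zeta>. \<chi> (inv\<^bsub>sym_group d\<^esub> (coset_action (sym_group d) W I \<zeta> i) \<otimes>\<^bsub>sym_group d\<^esub> \<zeta> \<otimes>\<^bsub>sym_group d\<^esub> i)) \<sigma>)"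
proof -
  let ?G = "sym_group d"
  let ?\<phi> = "\<lambda>\<zeta>. restrict (coset_action ?G W I \<zeta>) I"
  let ?b = "\<lambda>i \<zeta>. \<chi> (inv\<^bsub>?G\<^esub> (coset_action ?G W I \<zeta> i) \<otimes>\<^bsub>?G\<^esub> \<zeta> \<otimes>\<^bsub>?G\<^esub> i)"
  interpret G: group ?G by (rule sym_group_is_group)
  interpret W: subgroup W ?G by fact
  interpret monomial_action ?G I ?\<phi> ?b
    using G.monomial_action_cosets[OF W I] \<chi> by (simp add: one_dim_characters_def)
  have IG: "I \<subseteq> carrier ?G" using I by (simp add: left_transversal_def)
  have "W \<in> lcosets\<^bsub>?G\<^esub> W"
    using G.lcos_mult_one[OF W.subset] by (force simp: LCOSETS_def)
  \<comment> \<open>\<open>e\<close> need not be the identity, but it lies in \<open>W\<close>, so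
    its stabilizer, a conjugate of \<open>W\<close> by \<open>e\<close>, is \<open>W\<close>
    itself.\<close>
  then obtain e where e: "e \<in> I" "e \<in> W"
    using I unfolding left_transversal_def by blast
  have ec: "e \<in> carrier ?G" using e IG by blast
  have s_iff: "coset_action ?G W I \<zeta> e = j \<longleftrightarrow> inv\<^bsub>?G\<^esub> j \<otimes>\<^bsub>?G\<^esub> \<zeta> \<otimes>\<^bsub>?G\<^esub> e \<in> W"
    if "\<zeta> \<in> carrier ?G" "j \<in> I" for \<zeta> j
    using G.coset_action[OF W I that(1) ec] G.coset_action_eqI[OF W I that(1) ec that(2)] by blast
  have stab: "stabilizer ?G ?\<phi> e = W"
  proof (rule Set.set_eqI, rule iffI)
    fix \<zeta> assume "\<zeta> \<in> stabilizer ?G ?\<phi> e"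
    then have \<zeta>: "\<zeta> \<in> carrier ?G" and w: "inv\<^bsub>?G\<^esub> e \<otimes>\<^bsub>?G\<^esub> \<zeta> \<otimes>\<^bsub>?G\<^esub> e \<in> W"
      using e s_iff by (auto simp: stabilizer_def)
    have "e \<otimes>\<^bsub>?G\<^esub> (inv\<^bsub>?G\<^esub> e \<otimes>\<^bsub>?G\<^esub> \<zeta> \<otimes>\<^bsub>?G\<^esub> e) \<otimes>\<^bsub>?G\<^esub> inv\<^bsub>?G\<^esub> e = \<zeta>"
      using G.conj_cancel(1)[OF ec \<zeta>] .
    then show "\<zeta> \<in> W" using w e(2) by (metis W.m_closed W.m_inv_closed)
  next
    fix \<zeta> assume "\<zeta> \<in> W"
    then have "inv\<^bsub>?G\<^esub> e \<otimes>\<^bsub>?G\<^esub> \<zeta> \<otimes>\<^bsub>?G\<^esub> e \<in> W"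
      using e(2) by (intro W.m_closed W.m_inv_closed)
    then show "\<zeta> \<in> stabilizer ?G ?\<phi> e"
      using e(1) s_iff \<open>\<zeta> \<in> W\<close> by (simp add: stabilizer_def)
  qed
  have orb: "Group_Action.orbit ?G ?\<phi> i = I" if i: "i \<in> I" for i
  proof
    show "Group_Action.orbit ?G ?\<phi> i \<subseteq> I"
      using action_closed[OF i] unfolding Group_Action.orbit_def by blast
    show "I \<subseteq> Group_Action.orbit ?G ?\<phi> i"
    proof
      fix j assume j: "j \<in> I"
      have jc: "j \<in> carrier ?G" and ic: "i \<in> carrier ?G" using i j IG by auto
      \<comment> \<open>The group element that carries \<open>i\<close> to \<open>j\<close>.\<close>
      let ?\<zeta> = "j \<otimes>\<^bsub>?G\<^esub> inv\<^bsub>?G\<^esub> i"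
      have \<zeta>: "?\<zeta> \<in> carrier ?G"
        using jc ic by (intro G.m_closed G.inv_closed)
      have "inv\<^bsub>?G\<^esub> j \<otimes>\<^bsub>?G\<^esub> ?\<zeta> \<otimes>\<^bsub>?G\<^esub> i = \<one>\<^bsub>?G\<^esub>"
        using jc ic by (rule G.inv_mult_cancel)
      then have "coset_action ?G W I ?\<zeta> i = j"
        using G.coset_action_eqI[OF W I \<zeta> ic j] W.one_closed by simp
      then show "j \<in> Group_Action.orbit ?G ?\<phi> i"
        using i \<zeta> unfolding Group_Action.orbit_def
        by (intro CollectI exI[of _ ?\<zeta>]) simp
    qed
  qed
  have "orbit_representatives ?G I ?\<phi> {e}"
    using e orb by (auto simp: orbit_representatives_def orbits_def)
  then have "char_map d (\<lambda>\<sigma>\<in>carrier ?G. fixed_point_sum I ?\<phi> ?b \<sigma>) = cyclic_index d W (?b e)"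
    using char_map_fixed_point_sum[OF monomial_action_axioms] finite_subset[OF IG finite_carrier_sym_group]
      stab by simp
  also have "\<dots> = cyclic_index d W \<chi>"
  proof -
    have \<chi>_mult: "\<chi> (x \<otimes>\<^bsub>?G\<^esub> y) = \<chi> x * \<chi> y" if "x \<in> W" "y \<in> W" for x y
      using \<chi> that by (auto simp: one_dim_characters_def hom_def units_of_mult)
    have "\<chi> e \<noteq> 0"
      using hom_in_carrier[OF \<chi>[unfolded one_dim_characters_def], of e] e(2)
      by (auto simp: units_of_carrier Units_def)
    \<comment> \<open>The cocycle at \<open>e\<close> is \<open>\<chi>\<close> conjugated by an
      element of \<open>W\<close>; as the values commute in the field, this changes nothing.\<close>
    have "?b e \<sigma> = \<chi> \<sigma>" if \<sigma>: "\<sigma> \<in> W" for \<sigma>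
    proof -
      have "inv\<^bsub>?G\<^esub> e \<otimes>\<^bsub>?G\<^esub> \<sigma> \<otimes>\<^bsub>?G\<^esub> e \<in> W"
        using \<sigma> e(2) by (intro W.m_closed W.m_inv_closed)
      then have "coset_action ?G W I \<sigma> e = e"
        using s_iff[OF W.mem_carrier[OF \<sigma>] e(1)] by simp
      moreover have "\<chi> e * \<chi> (inv\<^bsub>?G\<^esub> e \<otimes>\<^bsub>?G\<^esub> \<sigma> \<otimes>\<^bsub>?G\<^esub> e) = \<chi> \<sigma> * \<chi> e"
        using \<chi>_mult[of e "inv\<^bsub>?G\<^esub> e \<otimes>\<^bsub>?G\<^esub> \<sigma> \<otimes>\<^bsub>?G\<^esub> e"] \<chi>_mult[of \<sigma> e] \<sigma> e(2)
          G.conj_cancel(4)[OF ec, of \<sigma>] W.m_closed W.m_inv_closed W.mem_carrier by metis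
      ultimately show ?thesis using \<open>\<chi> e \<noteq> 0\<close> by simp
    qed
    then show ?thesis by (simp add: cyclic_index_def cong: sum.cong)
  qed
  finally show ?thesis by (rule sym)
qed

section \<open>Stabilizers of tuples and the product formula\<close>

lemma (in group) mem_conjugate_iff:
  assumes "subgroup H G" "x \<in> carrier G" "\<zeta> \<in> carrier G"
  shows "\<zeta> \<in> x <# H #> inv x \<longleftrightarrow> inv x \<otimes> \<zeta> \<otimes> x \<in> H"
proof
  interpret H: subgroup H G by fact
  assume "\<zeta> \<in> x <# H #> inv x"
  then obtain h where h: "h \<in> H" "\<zeta> = x \<otimes> h \<otimes> inv x"
    by (auto simp: l_coset_def r_coset_def)
  have "inv x \<otimes> \<zeta> \<otimes> x = h"
    using h(2) conj_cancel(2)[OF assms(2) H.mem_carrier[OF h(1)]] by simp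
  then show "inv x \<otimes> \<zeta> \<otimes> x \<in> H" using h by simp
next
  interpret H: subgroup H G by fact
  assume h: "inv x \<otimes> \<zeta> \<otimes> x \<in> H"
  have "\<zeta> = x \<otimes> (inv x \<otimes> \<zeta> \<otimes> x) \<otimes> inv x"
    using conj_cancel(1)[OF assms(2,3)] by simp
  then show "\<zeta> \<in> x <# H #> inv x"
    using h unfolding l_coset_def r_coset_def by blast
qed

lemma (in group) stabilizer_tuple_action:
  assumes W: "\<And>m. m \<in> {1..k} \<Longrightarrow> subgroup (W m) G"
    and I: "\<And>m. m \<in> {1..k} \<Longrightarrow> left_transversal G (W m) (I m)"
    and \<omega>: "\<omega> \<in> PiE {1..k} I" and k: "k \<ge> 1"
  shows "stabilizer G (tuple_action G k W I) \<omega> = conjugate_inter G k W \<omega>"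
proof -
  have \<omega>I: "\<omega> m \<in> I m" if "m \<in> {1..k}" for m
    using \<omega> that by (rule PiE_mem)
  have \<omega>G: "\<omega> m \<in> carrier G" if "m \<in> {1..k}" for m
    using \<omega>I[OF that] I[OF that] by (auto simp: left_transversal_def)
  \<comment> \<open>The first conjugate keeps the intersection inside the carrier; an intersection
    over no indices would be the whole type.\<close>
  have "conjugate_inter G k W \<omega> \<subseteq> \<omega> 1 <# W 1 #> inv (\<omega> 1)"
    using k by (auto simp: conjugate_inter_def)
  also have "\<dots> \<subseteq> carrier G"
    using W[of 1] \<omega>G[of 1] k
    by (intro r_coset_subset_G l_coset_subset_G) (auto simp: subgroup.subset)
  finally have sub: "conjugate_inter G k W \<omega> \<subseteq> carrier G" .
  have "tuple_action G k W I \<zeta> \<omega> = \<omega> \<longleftrightarrow> \<zeta> \<in> conjugate_inter G k W \<omega>" if \<zeta>: "\<zeta> \<in> carrier G" for \<zeta>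
  proof -
    have "tuple_action G k W I \<zeta> \<omega> = \<omega> \<longleftrightarrow> (\<forall>m\<in>{1..k}. coset_action G (W m) (I m) \<zeta> (\<omega> m) = \<omega> m)"
      using \<omega> by (simp add: tuple_action_def restrict_eq_iff PiE_def)
    also have "\<dots> \<longleftrightarrow> (\<forall>m\<in>{1..k}. inv (\<omega> m) \<otimes> \<zeta> \<otimes> \<omega> m \<in> W m)"
    proof (rule ball_cong[OF refl])
      fix m assume m: "m \<in> {1..k}"
      show "coset_action G (W m) (I m) \<zeta> (\<omega> m) = \<omega> m \<longleftrightarrow> inv (\<omega> m) \<otimes> \<zeta> \<otimes> \<omega> m \<in> W m"
        using coset_action(2)[OF W[OF m] I[OF m] \<zeta> \<omega>G[OF m]]
          coset_action_eqI[OF W[OF m] I[OF m] \<zeta> \<omega>G[OF m] \<omega>I[OF m]] by auto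
    qed
    also have "\<dots> \<longleftrightarrow> \<zeta> \<in> conjugate_inter G k W \<omega>"
      unfolding conjugate_inter_def using mem_conjugate_iff[OF W \<omega>G \<zeta>] by auto
    finally show ?thesis .
  qed
  then show ?thesis using sub by (auto simp: stabilizer_def)
qed

theorem theorem2p1p2:
  fixes d k :: nat
    and W I :: "nat \<Rightarrow> (nat \<Rightarrow> nat) set"
    and \<chi> :: "nat \<Rightarrow> (nat \<Rightarrow> nat) \<Rightarrow> 'K :: {alg_closed_field, field_char_0}"
    and T :: "(nat \<Rightarrow> nat \<Rightarrow> nat) set"
  assumes "d \<ge> 1" and "k \<ge> 1"
    and "\<And>m. m \<in> {1..k} \<Longrightarrow> subgroup (W m) (sym_group d)"
    and "\<And>m. m \<in> {1..k} \<Longrightarrow> \<chi> m \<in> one_dim_characters d (W m)"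
    and "\<And>m. m \<in> {1..k} \<Longrightarrow> left_transversal (sym_group d) (W m) (I m)"
    and "orbit_representatives (sym_group d) (PiE {1..k} I) (tuple_action (sym_group d) k W I) T"
  shows "internal_prod_upto d (\<lambda>m. cyclic_index d (W m) (\<chi> m)) k =
         (\<Sum>\<omega>\<in>T. cyclic_index d (conjugate_inter (sym_group d) k W \<omega>)
                                 (psi (sym_group d) k W \<chi> I \<omega>))"
proof -
  let ?G = "sym_group d"
  interpret G: group ?G by (rule sym_group_is_group)
  define \<phi> where "\<phi> m \<zeta> = restrict (coset_action ?G (W m) (I m) \<zeta>) (I m)" for m \<zeta>
  define b where "b m i \<zeta> =
    \<chi> m (inv\<^bsub>?G\<^esub> (coset_action ?G (W m) (I m) \<zeta> i) \<otimes>\<^bsub>?G\<^esub> \<zeta> \<otimes>\<^bsub>?G\<^esub> i)" for m i \<zeta>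
  \<comment> \<open>Tuples of every length \<open>j\<close> are treated, since the bracketing to the
    left makes the product of the first \<open>j\<close> factors the object of the
    induction.\<close>
  define \<Phi> where "\<Phi> j g = (\<lambda>\<omega>\<in>PiE {1..j} I. \<lambda>m\<in>{1..j}. \<phi> m g (\<omega> m))" for j g
  define B where "B j \<omega> g = (\<Prod>m=1..j. b m (\<omega> m) g)" for j \<omega> g
  have act: "monomial_action ?G (I m) (\<phi> m) (b m)" if m: "m \<in> {1..k}" for m
    using G.monomial_action_cosets[OF assms(3)[OF m] assms(5)[OF m]] assms(4)[OF m]
    unfolding \<phi>_def b_def by (simp add: one_dim_characters_def)
  have finI: "finite (I m)" if "m \<in> {1..k}" for m
    using assms(5)[OF that] finite_subset[OF _ finite_carrier_sym_group]
    by (auto simp: left_transversal_def)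
  have act_tuple: "monomial_action ?G (PiE {1..j} I) (\<Phi> j) (B j)" if "j \<le> k" for j
    unfolding \<Phi>_def B_def using that act by (intro G.monomial_action_PiE) auto
  have fin_tuple: "finite (PiE {1..j} I)" if "j \<le> k" for j
    using that finI by (intro finite_PiE) auto
  have fps_tuple: "fixed_point_sum (PiE {1..j} I) (\<Phi> j) (B j) g =
      (\<Prod>m=1..j. fixed_point_sum (I m) (\<phi> m) (b m) g)" if "j \<le> k" for j g
    unfolding \<Phi>_def B_def using that finI by (intro fixed_point_sum_PiE) auto
  let ?u = "\<lambda>j. \<lambda>\<sigma>\<in>carrier ?G. fixed_point_sum (PiE {1..j} I) (\<Phi> j) (B j) \<sigma>"
  let ?v = "\<lambda>m. \<lambda>\<sigma>\<in>carrier ?G. fixed_point_sum (I m) (\<phi> m) (b m) \<sigma>"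
  have Z: "cyclic_index d (W m) (\<chi> m) = char_map d (?v m)" if m: "m \<in> {1..k}" for m
    using cyclic_index_eq_char_map[OF assms(3)[OF m] assms(4)[OF m] assms(5)[OF m]]
    unfolding \<phi>_def b_def .
  \<comment> \<open>The invariant exhibits each partial product as the image of a virtual character,
    which is what allows the next internal product to be evaluated.\<close>
  have "internal_prod_upto d (\<lambda>m. cyclic_index d (W m) (\<chi> m)) j = char_map d (?u j)"
    if "1 \<le> j" "j \<le> k" for j
    using that
  proof (induction j rule: dec_induct)
    case base
    have "?v 1 = ?u 1"
      by (rule restrict_ext) (use fps_tuple[of 1] assms(2) in simp)
    have "internal_prod_upto d (\<lambda>m. cyclic_index d (W m) (\<chi> m)) 1 = cyclic_index d (W 1) (\<chi> 1)"
      by (simp add: internal_prod_upto_def)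
    also have "\<dots> = char_map d (?v 1)"
      by (rule Z) (use assms(2) in simp)
    also note \<open>?v 1 = ?u 1\<close>
    finally show ?case .
  next
    case (step j)
    have "internal_prod_upto d (\<lambda>m. cyclic_index d (W m) (\<chi> m)) (Suc j) =
        internal_prod d (internal_prod_upto d (\<lambda>m. cyclic_index d (W m) (\<chi> m)) j)
          (cyclic_index d (W (Suc j)) (\<chi> (Suc j)))"
      using step.hyps by (simp add: internal_prod_upto_def)
    also have "internal_prod_upto d (\<lambda>m. cyclic_index d (W m) (\<chi> m)) j = char_map d (?u j)"
      by (rule step.IH) (use step.prems in simp)
    also have "cyclic_index d (W (Suc j)) (\<chi> (Suc j)) = char_map d (?v (Suc j))"
      by (rule Z) (use step.prems in simp)
    also have "internal_prod d (char_map d (?u j)) (char_map d (?v (Suc j))) =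
        char_map d (\<lambda>\<sigma>\<in>carrier ?G. ?u j \<sigma> * ?v (Suc j) \<sigma>)"
      using step by (intro internal_prod_char_map fixed_point_sum_virtual_character act act_tuple fin_tuple finI) auto
    also have "(\<lambda>\<sigma>\<in>carrier ?G. ?u j \<sigma> * ?v (Suc j) \<sigma>) = ?u (Suc j)"
    proof (rule restrict_ext)
      fix \<sigma> assume "\<sigma> \<in> carrier ?G"
      then show "?u j \<sigma> * ?v (Suc j) \<sigma> = fixed_point_sum (PiE {1..Suc j} I) (\<Phi> (Suc j)) (B (Suc j)) \<sigma>"
        using step.prems fps_tuple[of j \<sigma>] fps_tuple[of "Suc j" \<sigma>] by simp
    qed
    finally show ?case .
  qed
  then have "internal_prod_upto d (\<lambda>m. cyclic_index d (W m) (\<chi> m)) k = char_map d (?u k)"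
    using assms(2) by simp
  moreover have \<Phi>_eq: "\<Phi> k = tuple_action ?G k W I"
    by (auto simp: \<Phi>_def tuple_action_def \<phi>_def fun_eq_iff)
  ultimately have "internal_prod_upto d (\<lambda>m. cyclic_index d (W m) (\<chi> m)) k =
      (\<Sum>\<omega>\<in>T. cyclic_index d (stabilizer ?G (tuple_action ?G k W I) \<omega>) (B k \<omega>))"
    using char_map_fixed_point_sum[OF act_tuple fin_tuple, of k T] assms(6) by simp
  also have "\<dots> = (\<Sum>\<omega>\<in>T. cyclic_index d (conjugate_inter ?G k W \<omega>) (psi ?G k W \<chi> I \<omega>))"
  proof (rule sum.cong[OF refl])
    fix \<omega> assume "\<omega> \<in> T"
    then have \<omega>: "\<omega> \<in> PiE {1..k} I" using assms(6) by (auto simp: orbit_representatives_def)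
    \<comment> \<open>A cyclic index evaluates its character only on the group it sums over, so the
      restriction in \<open>psi\<close> is invisible.\<close>
    have "cyclic_index d (conjugate_inter ?G k W \<omega>) (B k \<omega>) =
        cyclic_index d (conjugate_inter ?G k W \<omega>) (psi ?G k W \<chi> I \<omega>)"
      by (simp add: cyclic_index_def psi_def beta_def B_def b_def cong: sum.cong)
    then show "cyclic_index d (stabilizer ?G (tuple_action ?G k W I) \<omega>) (B k \<omega>) =
        cyclic_index d (conjugate_inter ?G k W \<omega>) (psi ?G k W \<chi> I \<omega>)"
      using G.stabilizer_tuple_action[OF assms(3,5) \<omega> assms(2)] by simp
  qed
  finally show ?thesis .
qed

end
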